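(* Let $\Omega\subset\mathbb{R}^d$ be a nonempty, bounded, uniform domain, and let $0<s<1$ and $0<\theta\le1$. If the weights $w,v$ belong to the Muckenhoupt class $A_1$, then the full seminorm $$[f]_{W^{s,1;\,w,v}(\Omega)}=\int_\Omega\int_\Omega\frac{|f(x)-f(y)|}{|x-y|^{d+s}}w(y)v(x)\,dy\,dx$$ and the truncated seminorm $$\int_\Omega\int_{B(x,\theta d_\Omega(x))}\frac{|f(x)-f(y)|}{|x-y|^{d+s}}\bigl(w(x)v(y)+w(y)v(x)\bigr)\,dy\,dx$$ are comparable for all $f\in L^1_{loc}(\Omega)$, i.e. each is bounded by a constant times the other, where the comparability constant depends on $\Omega,s,d,w,v$ and $\theta$ (and not on $f$).
   Context: Notation: $d_\Omega(x)=\mathrm{dist}(x,\partial\Omega)$. The seminorms may take the value $\infty$. Muckenhoupt class $A_1$: a positive weight $w$ on $\mathbb{R}^d$ belongs to $A_1$ if there is a constant $A>0$ such that $\frac1{|Q|}\int_Q w(x)\,dx\le A\inf_{y\in Q}w(y)$ for all cubes $Q\subset\mathbb{R}^d$. Uniform domain: a domain (connected open set) $\Omega\subset\mathbb{R}^d$ is uniform if there is a constant $C\ge1$ such that all $x,y\in\Omega$ can be joined by a curve $\gamma:[0,l]\to\Omega$, parameterized by arc length, with $l\le C|x-y|$ and $\mathrm{dist}(z,\partial\Omega)\ge\frac1C\min\{|z-x|,|z-y|\}$ for all $z\in\gamma$. *)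

theory Defs
  imports "HOL-Analysis.Analysis"
begin

(* Weights are identified up to null sets: positivity holds almost everywhere, and the infimum of
   w over a cube is the essential one, so that "average <= A * inf" says that the average is
   <= A * w y for almost every y in the cube.  With real-valued weights the pointwise
   infimum would exclude unbounded A1 weights such as |x| powr -a. *)

definition weight :: "('a::euclidean_space \<Rightarrow> real) \<Rightarrow> bool" where
  "weight w \<longleftrightarrow>
     (\<forall>K. compact K \<longrightarrow> w absolutely_integrable_on K) \<and> (AE x in lebesgue. 0 < w x)"

definition cubes :: "'a::euclidean_space set set" where
  "cubes = {cbox a (a + l *\<^sub>R One) | a l. 0 < l}"

definition muckenhoupt_A1 :: "('a::euclidean_space \<Rightarrow> real) set" where
  "muckenhoupt_A1 =
     {w. weight w \<and>
         (\<exists>A>0. \<forall>Q\<in>cubes. AE y in lebesgue. y \<in> Q \<longrightarrow>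
            (LINT x:Q|lebesgue. w x) / measure lebesgue Q \<le> A * w y)}"

definition curve_length :: "(real \<Rightarrow> 'a::metric_space) \<Rightarrow> real \<Rightarrow> real \<Rightarrow> ennreal" where
  "curve_length \<gamma> a b =
     (SUP (n, t) \<in> {(n :: nat, t :: nat \<Rightarrow> real). mono t \<and> range t \<subseteq> {a..b}}.
        \<Sum>k<n. ennreal (dist (\<gamma> (t k)) (\<gamma> (t (Suc k)))))"

definition arc_length_parametrized :: "(real \<Rightarrow> 'a::metric_space) \<Rightarrow> real \<Rightarrow> bool" where
  "arc_length_parametrized \<gamma> l \<longleftrightarrow>
     continuous_on {0..l} \<gamma> \<and>
     (\<forall>a b. 0 \<le> a \<and> a \<le> b \<and> b \<le> l \<longrightarrow> curve_length \<gamma> a b = ennreal (b - a))"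

(* infdist to the empty set is 0, so this is the distance to the boundary only for proper
   nonempty open sets. *)

definition bdist :: "'a::euclidean_space set \<Rightarrow> 'a \<Rightarrow> real" where
  "bdist \<Omega> x = infdist x (frontier \<Omega>)"

(* The whole space has no boundary: the distance to it is infinite and the second condition
   on the curve is void. *)

definition uniform_domain :: "'a::euclidean_space set \<Rightarrow> bool" where
  "uniform_domain \<Omega> \<longleftrightarrow>
     open \<Omega> \<and> connected \<Omega> \<and>
     (\<exists>C\<ge>1. \<forall>x\<in>\<Omega>. \<forall>y\<in>\<Omega>. \<exists>l\<ge>0. \<exists>\<gamma>.
        arc_length_parametrized \<gamma> l \<and> \<gamma> ` {0..l} \<subseteq> \<Omega> \<and> \<gamma> 0 = x \<and> \<gamma> l = y \<and>
        l \<le> C * norm (x - y) \<and>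
        (frontier \<Omega> \<noteq> {} \<longrightarrow>
           (\<forall>z\<in>\<gamma> ` {0..l}. bdist \<Omega> z \<ge> 1 / C * min (norm (z - x)) (norm (z - y)))))"

definition L1_loc :: "'a::euclidean_space set \<Rightarrow> ('a \<Rightarrow> real) set" where
  "L1_loc \<Omega> = {f. \<forall>K. compact K \<and> K \<subseteq> \<Omega> \<longrightarrow> f absolutely_integrable_on K}"

definition full_seminorm ::
  "real \<Rightarrow> ('a::euclidean_space \<Rightarrow> real) \<Rightarrow> ('a \<Rightarrow> real) \<Rightarrow> 'a set \<Rightarrow> ('a \<Rightarrow> real) \<Rightarrow> ennreal" where
  "full_seminorm s w v \<Omega> f =
     (\<integral>\<^sup>+x\<in>\<Omega>. (\<integral>\<^sup>+y\<in>\<Omega>.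
        ennreal (\<bar>f x - f y\<bar> / norm (x - y) powr (real DIM('a) + s) * (w y * v x))
      \<partial>lebesgue) \<partial>lebesgue)"

definition truncated_seminorm ::
  "real \<Rightarrow> real \<Rightarrow> ('a::euclidean_space \<Rightarrow> real) \<Rightarrow> ('a \<Rightarrow> real) \<Rightarrow> 'a set \<Rightarrow> ('a \<Rightarrow> real) \<Rightarrow> ennreal"
where
  "truncated_seminorm s \<theta> w v \<Omega> f =
     (\<integral>\<^sup>+x\<in>\<Omega>. (\<integral>\<^sup>+y\<in>ball x (\<theta> * bdist \<Omega> x).
        ennreal (\<bar>f x - f y\<bar> / norm (x - y) powr (real DIM('a) + s) * (w x * v y + w y * v x))
      \<partial>lebesgue) \<partial>lebesgue)"

end

theory Submission
  imports Defs
begin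

text \<open>
  Let $r = |x-y| \ge \theta\,\max(d_\Omega(x), d_\Omega(y))$, the only case in which the pair is not seen
  by the truncated seminorm.  A uniform domain contains, for each scale $2^{-k}r$, a point at
  distance $2^{-k-1}r$ from $x$ whose distance to the boundary is comparable to $2^{-k}r$, and two such points of
  consecutive scales are joined by boundedly many balls of comparable size (as are the first
  points for $x$ and for $y$).  Telescoping the averages of $f$ over these balls bounds
  $|f(x)-f(y)|$ by oscillations of $f$ over pairs $(u,u')$ with $|u-u'| < \theta d_\Omega(u)$ and
  $\max(|u-x|,|u-u'|) \le M 2^{-k}r$, with weight $(2^{-k}r)^{-2d}$, plus the mean oscillation at $x$ itself;
  and likewise for $y$.  After Tonelli, the
  integrals over $y$ and then over $x$ are tails $\int w(y)\max(|y-a|,\rho)^{-d-\sigma}dy$, which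
  the $A_1$ condition bounds by $\rho^{-\sigma}w(z)$ for almost every $z$ near $a$.  The sum over the scales
  becomes geometric with ratio $2^{-s}$, leaving $|u-u'|^{-d-s}w(u)v(u')$.
\<close>

section \<open>Mean oscillations\<close>

text \<open>The two kinds of terms land in different halves of the truncated seminorm, which is why
  its kernel carries both orders of the weights. The mean oscillation at x does not involve y, so
  integrating y moves w from y to a point z of the ball around x and leaves v(x)w(z). A chain term
  involves y through the scale alone: integrating y moves w to u, and integrating x afterwards moves
  v to u', leaving w(u)v(u'). The geometric factor arises as follows. Put m = max(|x-u|,|u-u'|). At
  the scale 2^-k |x-y| the kernel and the weight of the scale multiply to 2^(2dk) |x-y|^(-3d-s),
  restricted to |x-y| >= 2^k m/M. The tail of this in y is of order 2^(2dk) (2^k m)^(-2d-s) =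
  2^(-ks) m^(-2d-s): the powers 2^(2dk) cancel. The decay m^(-2d-s) is what makes the remaining
  integral over x a tail again, with value of order |u-u'|^(-d-s).\<close>

definition dev :: "('a::euclidean_space \<Rightarrow> real) \<Rightarrow> 'a \<Rightarrow> 'a set \<Rightarrow> ennreal" where
  "dev f x S = (\<integral>\<^sup>+u. ennreal \<bar>f x - f u\<bar> \<partial>uniform_measure lborel S)"

text \<open>Mean absolute differences stand in for differences of mean values: no average of f has
  to exist, and the estimates are inequalities in \<open>ennreal\<close>, infinity included.\<close>

definition mean_osc :: "('a::euclidean_space \<Rightarrow> real) \<Rightarrow> 'a set \<Rightarrow> 'a set \<Rightarrow> ennreal" where
  "mean_osc f R S = (\<integral>\<^sup>+u. dev f u S \<partial>uniform_measure lborel R)"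

text \<open>These conditions make \<open>uniform_measure lborel S\<close> a probability
  measure.\<close>

definition fat :: "'a::euclidean_space set \<Rightarrow> bool" where
  "fat S \<longleftrightarrow> S \<in> sets borel \<and> emeasure lborel S \<noteq> 0 \<and> emeasure lborel S \<noteq> \<infinity>"

lemma fat_ball:
  fixes a :: "'a::euclidean_space"
  assumes "0 < r"
  shows "fat (ball a r)"
proof -
  have "unit_ball_vol (real DIM('a)) \<noteq> 0"
    by (intro less_imp_neq[symmetric] unit_ball_vol_pos) simp
  then show ?thesis
    unfolding fat_def emeasure_ball[OF less_imp_le[OF assms]] using assms by auto
qed

lemma emeasure_uniform_measure_UNIV:
  "fat S \<Longrightarrow> emeasure (uniform_measure lborel S) UNIV = 1"
  by (simp add: fat_def emeasure_uniform_measure ennreal_divide_self less_top)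

lemma dev_density:
  assumes [measurable]: "f \<in> borel_measurable borel" and "fat S"
  shows "dev f x S = (\<integral>\<^sup>+u. ennreal \<bar>f x - f u\<bar> * indicator S u \<partial>lborel) / emeasure lborel S"
  using assms(2) unfolding dev_def fat_def by (intro nn_integral_uniform_measure) auto

lemma borel_measurable_dev [measurable]:
  assumes [measurable]: "f \<in> borel_measurable borel" and S: "fat S"
  shows "(\<lambda>x. dev f x S) \<in> borel_measurable borel"
proof -
  have [measurable]: "S \<in> sets borel"
    using S by (simp add: fat_def)
  show ?thesis
    unfolding dev_density[OF assms] by measurable
qed

lemma mean_osc_density:
  assumes [measurable]: "f \<in> borel_measurable borel" and "fat S" and "fat R"
  shows "mean_osc f R S =
    (\<integral>\<^sup>+u. (\<integral>\<^sup>+u'. ennreal \<bar>f u - f u'\<bar> * (indicator R u * indicator S u') \<partial>lborel) \<partial>lborel)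
      / (emeasure lborel R * emeasure lborel S)"
proof -
  have [measurable]: "S \<in> sets borel" "R \<in> sets borel"
    using assms by (simp_all add: fat_def)
  have "mean_osc f R S = (\<integral>\<^sup>+u. dev f u S * indicator R u \<partial>lborel) / emeasure lborel R"
    unfolding mean_osc_def using assms by (intro nn_integral_uniform_measure) auto
  also have "(\<integral>\<^sup>+u. dev f u S * indicator R u \<partial>lborel) =
     (\<integral>\<^sup>+u. (\<integral>\<^sup>+u'. ennreal \<bar>f u - f u'\<bar> * (indicator R u * indicator S u') \<partial>lborel)
        / emeasure lborel S \<partial>lborel)"
    unfolding dev_density[OF assms(1,2)]
    by (intro nn_integral_cong) (auto simp: indicator_def)
  also have "\<dots> = (\<integral>\<^sup>+u. (\<integral>\<^sup>+u'. ennreal \<bar>f u - f u'\<bar> * (indicator R u * indicator S u') \<partial>lborel)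
        \<partial>lborel) / emeasure lborel S"
    by (intro nn_integral_divide) measurable
  finally show ?thesis
    using assms(2,3) unfolding fat_def
    by (simp add: divide_ennreal_def ennreal_inverse_mult mult.assoc mult.commute[of "inverse (emeasure lborel R)"] top.not_eq_extremum)
qed

text \<open>Pass from x to u through an intermediate point z and average over z in R as well; the
  left side does not depend on z and R has total mass 1.\<close>

lemma dev_triangle:
  assumes [measurable]: "f \<in> borel_measurable borel" and "fat S" and "fat R"
  shows "dev f x S \<le> dev f x R + mean_osc f R S"
proof -
  have "dev f x S = (\<integral>\<^sup>+z. dev f x S \<partial>uniform_measure lborel R)"
    using assms by (simp add: emeasure_uniform_measure_UNIV)
  also have "\<dots> \<le> (\<integral>\<^sup>+z. ennreal \<bar>f x - f z\<bar> + dev f z S \<partial>uniform_measure lborel R)"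
  proof (rule nn_integral_mono)
    fix z
    have "dev f x S \<le> (\<integral>\<^sup>+u. ennreal \<bar>f x - f z\<bar> + ennreal \<bar>f z - f u\<bar> \<partial>uniform_measure lborel S)"
      unfolding dev_def by (intro nn_integral_mono) (simp flip: ennreal_plus)
    also have "\<dots> = ennreal \<bar>f x - f z\<bar> + dev f z S"
      using assms by (subst nn_integral_add) (auto simp: emeasure_uniform_measure_UNIV dev_def)
    finally show "dev f x S \<le> ennreal \<bar>f x - f z\<bar> + dev f z S" .
  qed
  also have "\<dots> = dev f x R + mean_osc f R S"
    using assms by (subst nn_integral_add) (auto simp: dev_def[of f x] mean_osc_def)
  finally show ?thesis .
qed

lemma mean_osc_triangle:
  assumes [measurable]: "f \<in> borel_measurable borel" and "fat S" and "fat R" and "fat T"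
  shows "mean_osc f T S \<le> mean_osc f T R + mean_osc f R S"
proof -
  have "mean_osc f T S \<le> (\<integral>\<^sup>+u. dev f u R + mean_osc f R S \<partial>uniform_measure lborel T)"
    unfolding mean_osc_def[of f T S] using assms by (intro nn_integral_mono dev_triangle)
  also have "\<dots> = mean_osc f T R + mean_osc f R S"
    using assms
    by (subst nn_integral_add) (auto simp: emeasure_uniform_measure_UNIV mean_osc_def[of f T R])
  finally show ?thesis .
qed

lemma mean_osc_chain:
  assumes f: "f \<in> borel_measurable borel" and "\<And>i. fat (B i)"
  shows "mean_osc f (B 0) (B (Suc n)) \<le> (\<Sum>i\<le>n. mean_osc f (B i) (B (Suc i)))"
proof (induction n)
  case (Suc n)
  have "mean_osc f (B 0) (B (Suc (Suc n))) \<le>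
      mean_osc f (B 0) (B (Suc n)) + mean_osc f (B (Suc n)) (B (Suc (Suc n)))"
    using assms by (intro mean_osc_triangle)
  then show ?case
    using Suc by (auto intro: order_trans add_right_mono)
qed simp

text \<open>Here the sets shrink towards x as the index grows, so \<open>dev_triangle\<close> is
  unrolled from the coarsest set, and each \<open>mean_osc\<close> has the finer set first.\<close>

lemma dev_chain:
  assumes f: "f \<in> borel_measurable borel" and "\<And>i. fat (B i)"
  shows "dev f x (B 0) \<le> dev f x (B n) + (\<Sum>i<n. mean_osc f (B (Suc i)) (B i))"
proof (induction n)
  case (Suc n)
  have "dev f x (B n) \<le> dev f x (B (Suc n)) + mean_osc f (B (Suc n)) (B n)"
    using assms by (intro dev_triangle)
  then show ?case
    using Suc by (auto simp: add.assoc add.left_commute intro: order_trans add_right_mono)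
qed simp

lemma abs_diff_le_dev:
  assumes [measurable]: "f \<in> borel_measurable borel" and "fat S"
  shows "ennreal \<bar>f x - f y\<bar> \<le> dev f x S + dev f y S"
proof -
  have "ennreal \<bar>f x - f y\<bar> = (\<integral>\<^sup>+z. ennreal \<bar>f x - f y\<bar> \<partial>uniform_measure lborel S)"
    using assms by (simp add: emeasure_uniform_measure_UNIV)
  also have "\<dots> \<le> (\<integral>\<^sup>+u. ennreal \<bar>f x - f u\<bar> + ennreal \<bar>f y - f u\<bar> \<partial>uniform_measure lborel S)"
    by (intro nn_integral_mono) (simp flip: ennreal_plus)
  also have "\<dots> = dev f x S + dev f y S"
    by (subst nn_integral_add) (auto simp: dev_def)
  finally show ?thesis .
qed

section \<open>Chains in uniform domains\<close>

lemma bdist_le: "bdist \<Omega> x \<le> bdist \<Omega> y + dist x y"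
  unfolding bdist_def by (rule infdist_triangle)

lemma borel_measurable_bdist [measurable]: "bdist \<Omega> \<in> borel_measurable borel"
  unfolding bdist_def by (intro borel_measurable_continuous_onI continuous_intros)

lemma bdist_pos:
  assumes "open \<Omega>" "frontier \<Omega> \<noteq> {}" "x \<in> \<Omega>"
  shows "0 < bdist \<Omega> x"
  using assms unfolding bdist_def
  by (intro infdist_pos_not_in_closed) (auto simp: frontier_def interior_open)

text \<open>A ball that contains x and leaves the domain is connected, so it meets the frontier, at
  a point closer to x than the frontier is.\<close>

lemma ball_bdist_subset:
  assumes "x \<in> \<Omega>"
  shows "ball x (bdist \<Omega> x) \<subseteq> \<Omega>"
proof (rule ccontr)
  assume *: "\<not> ?thesis"
  then have "0 < bdist \<Omega> x"
    by (metis ball_eq_empty empty_subsetI not_le)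
  then have "ball x (bdist \<Omega> x) \<inter> frontier \<Omega> \<noteq> {}"
    using * assms by (intro connected_Int_frontier) (auto simp: disjoint_iff intro: exI[of _ x])
  then obtain z where "z \<in> frontier \<Omega>" "dist x z < bdist \<Omega> x"
    by auto
  then show False
    using infdist_le[of z "frontier \<Omega>" x] by (simp add: bdist_def)
qed

text \<open>Uniformity in the form that the chains consume: curves of speed at most 1 and the
  boundary condition with C multiplied out. The frontier is nonempty, so \<open>bdist\<close> is a
  genuine distance, positive inside.\<close>

locale uniform_curves =
  fixes \<Omega> :: "'a::euclidean_space set" and C :: real
  assumes open_domain: "open \<Omega>" and frontier: "frontier \<Omega> \<noteq> {}" and C_ge_1: "1 \<le> C"
    and curve: "\<And>x y. x \<in> \<Omega> \<Longrightarrow> y \<in> \<Omega> \<Longrightarrow>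
      \<exists>l\<ge>0. \<exists>\<gamma>. l \<le> C * dist x y \<and> 1-lipschitz_on {0..l} \<gamma> \<and> \<gamma> ` {0..l} \<subseteq> \<Omega> \<and> \<gamma> 0 = x \<and> \<gamma> l = y \<and>
        (\<forall>z\<in>\<gamma> ` {0..l}. min (dist z x) (dist z y) \<le> C * bdist \<Omega> z)"

lemma arc_length_parametrized_lipschitz:
  assumes "arc_length_parametrized \<gamma> l"
  shows "1-lipschitz_on {0..l} \<gamma>"
proof (rule lipschitz_onI)
  have *: "dist (\<gamma> a) (\<gamma> b) \<le> b - a" if "0 \<le> a" "a \<le> b" "b \<le> l" for a b
  proof -
    \<comment> \<open>A partition is an infinite monotone sequence. This one stays at b after its
      first step, and its sum of one term is the chord.\<close>
    let ?t = "\<lambda>k::nat. if k = 0 then a else b"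
    have "(\<Sum>k<1. ennreal (dist (\<gamma> (?t k)) (\<gamma> (?t (Suc k))))) \<le> curve_length \<gamma> a b"
      unfolding curve_length_def
      using that by (intro SUP_upper2[of "(1, ?t)"]) (auto simp: mono_def)
    also have "\<dots> = ennreal (b - a)"
      using assms that by (simp add: arc_length_parametrized_def)
    finally show ?thesis
      using that by simp
  qed
  show "dist (\<gamma> a) (\<gamma> b) \<le> 1 * dist a b" if "a \<in> {0..l}" "b \<in> {0..l}" for a b
    using *[of a b] *[of b a] that by (cases "a \<le> b") (auto simp: dist_commute dist_real_def)
qed simp

lemma uniform_domain_curves:
  assumes "uniform_domain \<Omega>" "frontier \<Omega> \<noteq> {}"
  shows "\<exists>C. uniform_curves \<Omega> C"
proof -
  obtain C where C: "C \<ge> 1" and curves: "\<forall>x\<in>\<Omega>. \<forall>y\<in>\<Omega>. \<exists>l\<ge>0. \<exists>\<gamma>.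
        arc_length_parametrized \<gamma> l \<and> \<gamma> ` {0..l} \<subseteq> \<Omega> \<and> \<gamma> 0 = x \<and> \<gamma> l = y \<and>
        l \<le> C * norm (x - y) \<and>
        (frontier \<Omega> \<noteq> {} \<longrightarrow>
           (\<forall>z\<in>\<gamma> ` {0..l}. bdist \<Omega> z \<ge> 1 / C * min (norm (z - x)) (norm (z - y))))"
    using assms(1) unfolding uniform_domain_def by blast
  have "uniform_curves \<Omega> C"
  proof
    show "open \<Omega>" "frontier \<Omega> \<noteq> {}" "1 \<le> C"
      using assms C by (auto simp: uniform_domain_def)
    fix x y assume "x \<in> \<Omega>" "y \<in> \<Omega>"
    then obtain l \<gamma> where "l \<ge> 0" "arc_length_parametrized \<gamma> l" "\<gamma> ` {0..l} \<subseteq> \<Omega>"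
      "\<gamma> 0 = x" "\<gamma> l = y" "l \<le> C * norm (x - y)"
      and *: "\<forall>z\<in>\<gamma> ` {0..l}. bdist \<Omega> z \<ge> 1 / C * min (norm (z - x)) (norm (z - y))"
      using curves assms(2) by blast
    moreover have "min (dist z x) (dist z y) \<le> C * bdist \<Omega> z" if "z \<in> \<gamma> ` {0..l}" for z
      using *[rule_format, OF that] C by (simp add: field_simps dist_norm)
    ultimately show "\<exists>l\<ge>0. \<exists>\<gamma>. l \<le> C * dist x y \<and> 1-lipschitz_on {0..l} \<gamma> \<and> \<gamma> ` {0..l} \<subseteq> \<Omega> \<and>
        \<gamma> 0 = x \<and> \<gamma> l = y \<and> (\<forall>z\<in>\<gamma> ` {0..l}. min (dist z x) (dist z y) \<le> C * bdist \<Omega> z)"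
      by (auto simp: dist_norm intro!: exI[of _ l] exI[of _ \<gamma>] arc_length_parametrized_lipschitz)
  qed
  then show ?thesis ..
qed

context uniform_curves
begin

text \<open>The intermediate value theorem along the curve from x to y. As \<rho> is at most half of
  |x-y|, the point found is also at least \<rho> away from y, so the minimum in the boundary
  condition is \<rho>.\<close>

lemma exists_at_distance:
  assumes "x \<in> \<Omega>" "y \<in> \<Omega>" "0 \<le> \<rho>" "\<rho> \<le> dist x y / 2"
  shows "\<exists>p\<in>\<Omega>. dist p x = \<rho> \<and> \<rho> \<le> C * bdist \<Omega> p"
proof -
  obtain l :: real and \<gamma> where l: "l \<ge> 0" "1-lipschitz_on {0..l} \<gamma>" "\<gamma> ` {0..l} \<subseteq> \<Omega>" "\<gamma> 0 = x" "\<gamma> l = y"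
    and far: "\<And>z. z \<in> \<gamma> ` {0..l} \<Longrightarrow> min (dist z x) (dist z y) \<le> C * bdist \<Omega> z"
    using curve[OF assms(1,2)] by blast
  have "continuous_on {0..l} (\<lambda>t. dist (\<gamma> t) x)"
    using lipschitz_on_continuous_on[OF l(2)] by (intro continuous_intros)
  moreover have "dist (\<gamma> l) x \<ge> \<rho>" "dist (\<gamma> 0) x \<le> \<rho>"
    using l assms zero_le_dist[of x y] by (auto simp: dist_commute)
  ultimately obtain t where t: "t \<in> {0..l}" "dist (\<gamma> t) x = \<rho>"
    using IVT'[of "\<lambda>t. dist (\<gamma> t) x" 0 \<rho> l] l(1) by auto
  have "\<rho> \<le> dist (\<gamma> t) y"
    using dist_triangle[of x y "\<gamma> t"] t(2) assms(4) by (simp add: dist_commute)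
  then have "\<rho> \<le> C * bdist \<Omega> (\<gamma> t)"
    using far[of "\<gamma> t"] t by auto
  then show ?thesis
    using t l by blast
qed

text \<open>Sample the curve at equal time steps; its speed and length control the steps and the
  distance to a. Within \<delta>/2 of an end point, the boundary distance is inherited from that end
  point; elsewhere the curve condition gives \<delta>/(2C). N stays free so that the steps can be
  made short compared with the radii of balls placed on the chain.\<close>

lemma harnack_chain:
  assumes "a \<in> \<Omega>" "b \<in> \<Omega>" "\<delta> \<le> bdist \<Omega> a" "\<delta> \<le> bdist \<Omega> b" "0 < \<delta>" "0 < N"
  shows "\<exists>p::nat \<Rightarrow> 'a. p 0 = a \<and> p N = b \<and>
    (\<forall>i\<le>N. p i \<in> \<Omega> \<and> \<delta> / (2 * C) \<le> bdist \<Omega> (p i) \<and> dist (p i) a \<le> C * dist a b) \<and>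
    (\<forall>i<N. dist (p i) (p (Suc i)) \<le> C * dist a b / N)"
proof -
  obtain l :: real and \<gamma> where l: "l \<ge> 0" "l \<le> C * dist a b" "1-lipschitz_on {0..l} \<gamma>" "\<gamma> ` {0..l} \<subseteq> \<Omega>"
      "\<gamma> 0 = a" "\<gamma> l = b"
    and far: "\<And>z. z \<in> \<gamma> ` {0..l} \<Longrightarrow> min (dist z a) (dist z b) \<le> C * bdist \<Omega> z"
    using curve[OF assms(1,2)] by blast
  have lip: "dist (\<gamma> t) (\<gamma> u) \<le> \<bar>t - u\<bar>" if "t \<in> {0..l}" "u \<in> {0..l}" for t u
    using lipschitz_onD[OF l(3) that] by (simp add: dist_real_def)
  define p where "p i = \<gamma> (real i * l / N)" for i :: nat
  have in_dom: "real i * l / N \<in> {0..l}" if "i \<le> N" for i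
    using that l(1) assms(6) by (auto simp: field_simps mult_left_mono)
  have "p i \<in> \<Omega>" if "i \<le> N" for i
    using in_dom[OF that] l(4) by (auto simp: p_def)
  moreover have "\<delta> / (2 * C) \<le> bdist \<Omega> (p i)" if "i \<le> N" for i
  proof -
    have z: "p i \<in> \<gamma> ` {0..l}"
      using in_dom[OF that] by (auto simp: p_def)
    have "\<delta> \<le> \<delta> * C"
      using C_ge_1 \<open>0 < \<delta>\<close> by simp
    then have le: "\<delta> / (2 * C) \<le> \<delta> / 2"
      using C_ge_1 by (simp add: field_simps)
    consider "dist (p i) a \<le> \<delta> / 2" | "dist (p i) b \<le> \<delta> / 2"
      | "\<delta> / 2 \<le> min (dist (p i) a) (dist (p i) b)"
      by linarith
    then show ?thesis
    proof cases
      case 1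
      then show ?thesis
        using bdist_le[of \<Omega> a "p i"] le assms(3) by (simp add: dist_commute)
    next
      case 2
      then show ?thesis
        using bdist_le[of \<Omega> b "p i"] le assms(4) by (simp add: dist_commute)
    next
      case 3
      then have "\<delta> / 2 \<le> C * bdist \<Omega> (p i)"
        using far[OF z] by linarith
      then show ?thesis
        using C_ge_1 by (simp add: field_simps)
    qed
  qed
  moreover have "dist (p i) a \<le> C * dist a b" if "i \<le> N" for i
    using lip[OF in_dom[OF that], of 0] in_dom[OF that] l by (auto simp: p_def)
  moreover have "dist (p i) (p (Suc i)) \<le> C * dist a b / N" if "i < N" for i
  proof -
    have "dist (p i) (p (Suc i)) \<le> \<bar>real i * l / N - real (Suc i) * l / N\<bar>"
      unfolding p_def using that by (intro lip in_dom) auto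
    also have "\<dots> = l / N"
      using l(1) by (simp add: field_simps flip: diff_divide_distrib)
    also have "\<dots> \<le> C * dist a b / N"
      using l(2) by (intro divide_right_mono) auto
    finally show ?thesis .
  qed
  ultimately show ?thesis
    using l assms(6) by (intro exI[of _ p]) (auto simp: p_def)
qed

end

section \<open>The pointwise estimate\<close>

text \<open>The differences that the truncated seminorm sees. The value 0 for all other pairs lets
  every integral run over the whole space.\<close>

definition osc :: "'a::euclidean_space set \<Rightarrow> real \<Rightarrow> ('a \<Rightarrow> real) \<Rightarrow> 'a \<Rightarrow> 'a \<Rightarrow> ennreal" where
  "osc \<Omega> \<theta> f u u' = (if u \<in> \<Omega> \<and> dist u u' < \<theta> * bdist \<Omega> u then ennreal \<bar>f u - f u'\<bar> else 0)"

text \<open>Bounding $t^{-d-s}$ by $|u-u'|^{-d-s}$ already here would lose a logarithm: the decay in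
  $|u-u'|/t$ makes the sum over all scales $t$ above $|u-u'|$ converge.\<close>

definition local_osc ::
  "'a::euclidean_space set \<Rightarrow> real \<Rightarrow> ('a \<Rightarrow> real) \<Rightarrow> real \<Rightarrow> 'a \<Rightarrow> real \<Rightarrow> ennreal" where
  "local_osc \<Omega> \<theta> f M x t = (\<integral>\<^sup>+u. (\<integral>\<^sup>+u'. osc \<Omega> \<theta> f u u' *
     ennreal (if dist u x \<le> M * t \<and> dist u u' \<le> M * t then t powr (- 2 * real DIM('a)) else 0)
     \<partial>lborel) \<partial>lborel)"

text \<open>Up to a constant depending on \<theta> and the dimension, the mean of |f(x)-f(z)| over
  the ball of radius \<theta> d(x), where d is \<open>bdist\<close>.\<close>

definition end_osc :: "'a::euclidean_space set \<Rightarrow> real \<Rightarrow> ('a \<Rightarrow> real) \<Rightarrow> 'a \<Rightarrow> ennreal" where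
  "end_osc \<Omega> \<theta> f x = (\<integral>\<^sup>+z. osc \<Omega> \<theta> f x z \<partial>lborel) * ennreal (bdist \<Omega> x powr - real DIM('a))"

lemma borel_measurable_osc [measurable]:
  assumes [measurable]: "f \<in> borel_measurable borel" "\<Omega> \<in> sets borel"
    "g \<in> borel_measurable M" "h \<in> borel_measurable M"
  shows "(\<lambda>x. osc \<Omega> \<theta> f (g x) (h x)) \<in> borel_measurable M"
  unfolding osc_def by measurable

lemma divide_ennreal_le:
  assumes "0 < v" "v \<le> w"
  shows "X / ennreal w \<le> X * ennreal (1 / v)"
  using assms unfolding divide_ennreal_def
  by (auto simp: inverse_ennreal inverse_eq_divide intro!: mult_left_mono ennreal_leI divide_left_mono)

text \<open>The double average is a double integral divided by two volumes of order t^d, which gives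
  the power -2d. The radii range over a factor 2 because balls of the consecutive scales t and t/2
  have to be compared.\<close>

lemma mean_osc_le_local_osc:
  fixes a b x :: "'a::euclidean_space"
  assumes [measurable]: "f \<in> borel_measurable borel" and "open \<Omega>"
    and "0 < t" "0 < \<eta>" "0 < \<theta>" "\<theta> \<le> 1"
    and "\<eta> * t / 2 \<le> \<rho>" "\<rho> \<le> \<eta> * t" "\<eta> * t / 2 \<le> \<rho>'" "\<rho>' \<le> \<eta> * t"
    and "a \<in> \<Omega>" "\<kappa> * t \<le> bdist \<Omega> a" "dist a b \<le> \<eta> * t" "4 * \<eta> \<le> \<theta> * \<kappa>"
    and "dist a x + \<eta> * t \<le> M * t" "3 * \<eta> \<le> M"
  shows "mean_osc f (ball a \<rho>) (ball b \<rho>') \<le>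
    ennreal ((2 ^ DIM('a) / (unit_ball_vol (real DIM('a)) * \<eta> ^ DIM('a)))\<^sup>2) * local_osc \<Omega> \<theta> f M x t"
proof -
  let ?n = "DIM('a)" and ?w = "unit_ball_vol (real DIM('a))"
  let ?K = "(2 ^ ?n / (?w * \<eta> ^ ?n))\<^sup>2" and ?T = "t powr (- 2 * real ?n)"
  have [measurable]: "\<Omega> \<in> sets borel"
    using \<open>open \<Omega>\<close> by auto
  have pos: "0 < \<rho>" "0 < \<rho>'" "0 < ?w"
    using assms by (auto intro: less_le_trans[of _ "\<eta> * t / 2"])
  \<comment> \<open>Volume of the smallest admissible ball, of radius \<eta>t/2.\<close>
  define v where "v = ?w * (\<eta> * t / 2) ^ ?n"
  have v: "0 < v" "v \<le> ?w * \<rho> ^ ?n" "v \<le> ?w * \<rho>' ^ ?n"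
    using assms pos unfolding v_def by (auto intro!: mult_left_mono power_mono)
  have "?T = 1 / (t ^ ?n)\<^sup>2"
    using \<open>0 < t\<close> powr_realpow[of t "2 * ?n"]
    by (simp add: powr_minus field_simps power_even_eq power_mult)
  then have K: "1 / (v * v) = ?K * ?T"
    by (simp add: v_def power_mult_distrib power_divide power2_eq_square)
  have inv: "X / (ennreal (?w * \<rho> ^ ?n) * ennreal (?w * \<rho>' ^ ?n)) \<le> X * ennreal (?K * ?T)" for X
  proof -
    have "X / ennreal ((?w * \<rho> ^ ?n) * (?w * \<rho>' ^ ?n)) \<le> X * ennreal (1 / (v * v))"
      using v by (intro divide_ennreal_le mult_mono) auto
    then show ?thesis
      using pos unfolding K by (simp add: ennreal_mult)
  qed
  \<comment> \<open>Each of |a-u|, |a-b|, |b-u'| is at most \<eta>t, the first strictly, so |u-u'| <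
    3\<eta>t. On the other side, \<theta> d(u) is at least \<theta>\<kappa>t - \<theta>\<eta>t >=
    4\<eta>t - \<eta>t. This is the origin of 4\<eta> <= \<theta>\<kappa>: every pair from the two
    balls is visible.\<close>
  have step: "ennreal \<bar>f u - f u'\<bar> * (indicator (ball a \<rho>) u * indicator (ball b \<rho>') u') \<le>
      osc \<Omega> \<theta> f u u' * (if dist u x \<le> M * t \<and> dist u u' \<le> M * t then 1 else 0)" for u u'
  proof (cases "dist a u < \<rho> \<and> dist b u' < \<rho>'")
    case True
    have "4 * (\<eta> * t) \<le> \<theta> * (\<kappa> * t)"
      using mult_right_mono[OF assms(14), of t] \<open>0 < t\<close> by (simp add: mult.assoc)
    moreover have "\<theta> * (\<kappa> * t) \<le> \<theta> * bdist \<Omega> a"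
      using assms by (intro mult_left_mono) auto
    moreover have "\<theta> * bdist \<Omega> a \<le> \<theta> * (bdist \<Omega> u + dist a u)"
      using assms bdist_le[of \<Omega> a u] by (intro mult_left_mono) auto
    moreover have "\<theta> * bdist \<Omega> a \<le> 1 * bdist \<Omega> a"
      using assms by (intro mult_right_mono) (auto simp: bdist_def infdist_nonneg)
    moreover have "\<theta> * dist a u \<le> 1 * dist a u"
      using assms by (intro mult_right_mono) auto
    moreover have "dist u u' \<le> dist a u + dist a b + dist b u'" "dist u x \<le> dist a u + dist a x"
      by (metis dist_commute dist_triangle_le add.commute add_mono dist_triangle2 dist_triangle3 order_refl add.assoc)+
    moreover have "0 < \<eta> * t"
      using assms by simp
    moreover have "3 * (\<eta> * t) \<le> M * t"
      using mult_right_mono[OF assms(16), of t] \<open>0 < t\<close> by (simp add: mult.assoc)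
    ultimately have "dist a u < bdist \<Omega> a" "dist u u' < \<theta> * bdist \<Omega> u" "dist u x \<le> M * t"
        "dist u u' \<le> M * t"
      using assms(7-13,15) True unfolding distrib_left by linarith+
    moreover have "u \<in> \<Omega>"
      using ball_bdist_subset[OF \<open>a \<in> \<Omega>\<close>] calculation(1) by auto
    ultimately show ?thesis
      by (auto simp: osc_def indicator_def)
  qed (auto simp: indicator_def)
  have "mean_osc f (ball a \<rho>) (ball b \<rho>') \<le>
    (\<integral>\<^sup>+u. (\<integral>\<^sup>+u'. ennreal \<bar>f u - f u'\<bar> *
      (indicator (ball a \<rho>) u * indicator (ball b \<rho>') u') \<partial>lborel) \<partial>lborel) * ennreal (?K * ?T)"
    unfolding mean_osc_density[OF assms(1) fat_ball[OF pos(2)] fat_ball[OF pos(1)]]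
    using inv pos by (simp add: emeasure_ball)
  also have "\<dots> \<le> (\<integral>\<^sup>+u. (\<integral>\<^sup>+u'. osc \<Omega> \<theta> f u u' *
      (if dist u x \<le> M * t \<and> dist u u' \<le> M * t then 1 else 0) \<partial>lborel) \<partial>lborel) * ennreal (?K * ?T)"
    by (intro mult_right_mono nn_integral_mono step) auto
  also have "\<dots> = ennreal ?K * ((\<integral>\<^sup>+u. (\<integral>\<^sup>+u'. osc \<Omega> \<theta> f u u' *
      (if dist u x \<le> M * t \<and> dist u u' \<le> M * t then 1 else 0) \<partial>lborel) \<partial>lborel) * ennreal ?T)"
    by (simp add: ennreal_mult mult_ac)
  also have "(\<integral>\<^sup>+u. (\<integral>\<^sup>+u'. osc \<Omega> \<theta> f u u' *
      (if dist u x \<le> M * t \<and> dist u u' \<le> M * t then 1 else 0) \<partial>lborel) \<partial>lborel) * ennreal ?T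
      = local_osc \<Omega> \<theta> f M x t"
    unfolding local_osc_def
    by (subst nn_integral_multc[symmetric], measurable, intro nn_integral_cong,
        subst nn_integral_multc[symmetric], measurable, intro nn_integral_cong) (auto simp: mult.assoc)
  finally show ?thesis .
qed

text \<open>For the last ball of a chain: it lies in the ball visible from x, and its radius is not
  small compared with d(x), so averaging over it costs only a constant.\<close>

lemma dev_le_end_osc:
  fixes x p :: "'a::euclidean_space"
  assumes [measurable]: "f \<in> borel_measurable borel" and "open \<Omega>" "frontier \<Omega> \<noteq> {}"
    and "x \<in> \<Omega>" "0 < \<eta>" "\<eta> * bdist \<Omega> x \<le> \<rho>" "ball p \<rho> \<subseteq> ball x (\<theta> * bdist \<Omega> x)"
  shows "dev f x (ball p \<rho>) \<le> ennreal (1 / (unit_ball_vol (real DIM('a)) * \<eta> ^ DIM('a))) * end_osc \<Omega> \<theta> f x"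
proof -
  let ?n = "DIM('a)" and ?w = "unit_ball_vol (real DIM('a))" and ?d = "bdist \<Omega> x"
  have [measurable]: "\<Omega> \<in> sets borel"
    using \<open>open \<Omega>\<close> by auto
  have d: "0 < ?d"
    using assms by (intro bdist_pos)
  have pos: "0 < \<rho>" "0 < ?w"
    using assms d by (auto intro: less_le_trans[of _ "\<eta> * ?d"])
  define v where "v = ?w * (\<eta> * ?d) ^ ?n"
  have v: "0 < v" "v \<le> ?w * \<rho> ^ ?n"
    using assms pos d unfolding v_def by (auto intro!: mult_left_mono power_mono)
  have K: "1 / v = 1 / (?w * \<eta> ^ ?n) * ?d powr - real ?n"
    using d by (simp add: v_def powr_minus powr_realpow power_mult_distrib field_simps)
  have "dev f x (ball p \<rho>) = (\<integral>\<^sup>+u. ennreal \<bar>f x - f u\<bar> * indicator (ball p \<rho>) u \<partial>lborel) / ennreal (?w * \<rho> ^ ?n)"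
    using pos by (simp add: dev_density fat_ball emeasure_ball)
  also have "\<dots> \<le> (\<integral>\<^sup>+u. ennreal \<bar>f x - f u\<bar> * indicator (ball p \<rho>) u \<partial>lborel) * ennreal (1 / v)"
    by (intro divide_ennreal_le v)
  also have "\<dots> \<le> (\<integral>\<^sup>+u. osc \<Omega> \<theta> f x u \<partial>lborel) * ennreal (1 / v)"
    using assms by (intro mult_right_mono nn_integral_mono) (auto simp: indicator_def osc_def subset_eq)
  finally show ?thesis
    using pos assms unfolding K end_osc_def by (simp add: ennreal_mult mult_ac del: times_divide_eq_right times_divide_eq_left mult_1_left mult_1_right)
qed

section \<open>Oscillation along chains of balls\<close>

context uniform_curves
begin

text \<open>Origin of the constants. With \<delta> = t/(4C), \<open>harnack_chain\<close> keeps its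
  points at distance t/(8C^2) from the boundary, so 4\<eta> <= \<theta>/(8C^2) is required, and
  \<eta> = \<theta>/(64C^2) satisfies it. The points lie within C|a-b| <= 2Ct of a, which lies
  within t of x; one more t in M makes room for the radius of a ball.\<close>

lemma mean_osc_harnack:
  assumes "0 < \<theta>" "\<theta> \<le> 1" and \<eta>: "\<eta> = \<theta> / (64 * C\<^sup>2)" and M: "M = 2 * C + 2"
  shows "\<exists>K>0. \<forall>f\<in>borel_measurable borel. \<forall>x t a b \<rho> \<rho>'. 0 < t \<longrightarrow> a \<in> \<Omega> \<longrightarrow> b \<in> \<Omega> \<longrightarrow>
    t / (4 * C) \<le> bdist \<Omega> a \<longrightarrow> t / (4 * C) \<le> bdist \<Omega> b \<longrightarrow> dist a b \<le> 2 * t \<longrightarrow> dist a x \<le> t \<longrightarrow>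
    \<rho> \<in> {\<eta> * t / 2..\<eta> * t} \<longrightarrow> \<rho>' \<in> {\<eta> * t / 2..\<eta> * t} \<longrightarrow>
    mean_osc f (ball a \<rho>) (ball b \<rho>') \<le> ennreal K * local_osc \<Omega> \<theta> f M x t"
proof -
  let ?K = "(2 ^ DIM('a) / (unit_ball_vol (real DIM('a)) * \<eta> ^ DIM('a)))\<^sup>2"
  define \<kappa> where "\<kappa> = 1 / (8 * C\<^sup>2)"
  have C2: "1 \<le> C\<^sup>2"
    using C_ge_1 by (rule one_le_power)
  have "\<theta> \<le> C\<^sup>2"
    using assms(2) C2 by linarith
  then have \<eta>_pos: "0 < \<eta>" and \<eta>_small: "\<eta> \<le> 1 / 64"
    unfolding \<eta> using assms(1) C_ge_1 by (auto simp: field_simps)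
  have \<kappa>: "4 * \<eta> \<le> \<theta> * \<kappa>" "0 < \<kappa>"
    using assms C2 C_ge_1 frac_le[of \<theta> \<theta> "8 * C\<^sup>2" "16 * C\<^sup>2"]
    by (auto simp: \<kappa>_def)
  \<comment> \<open>With this N the steps, at most 2Ct/N, do not exceed \<eta>t. Steps and radii
    both scale with t, so one N serves all scales and K is uniform.\<close>
  obtain N :: nat where N: "2 * C / \<eta> \<le> real N" "0 < N"
    using C_ge_1 \<eta>_pos by (metis divide_pos_pos of_nat_0_less_iff order_less_le_trans real_arch_simple
        zero_less_numeral less_le_trans mult_pos_pos zero_less_one)
  have "mean_osc f (ball a \<rho>) (ball b \<rho>') \<le> ennreal (N * ?K) * local_osc \<Omega> \<theta> f M x t"
    if f: "f \<in> borel_measurable borel" and t: "0 < t" and ab: "a \<in> \<Omega>" "b \<in> \<Omega>"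
      "t / (4 * C) \<le> bdist \<Omega> a" "t / (4 * C) \<le> bdist \<Omega> b" "dist a b \<le> 2 * t" "dist a x \<le> t"
      and \<rho>: "\<rho> \<in> {\<eta> * t / 2..\<eta> * t}" "\<rho>' \<in> {\<eta> * t / 2..\<eta> * t}" for f x t a b \<rho> \<rho>'
  proof -
    have "0 < t / (4 * C)"
      using t C_ge_1 by simp
    then obtain p where p: "p 0 = a" "p N = b"
      "\<And>i. i \<le> N \<Longrightarrow> p i \<in> \<Omega>" "\<And>i. i \<le> N \<Longrightarrow> t / (4 * C) / (2 * C) \<le> bdist \<Omega> (p i)"
      "\<And>i. i \<le> N \<Longrightarrow> dist (p i) a \<le> C * dist a b"
      "\<And>i. i < N \<Longrightarrow> dist (p i) (p (Suc i)) \<le> C * dist a b / N"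
      using harnack_chain[OF ab(1-4) _ N(2)] by blast
    \<comment> \<open>Only the last ball has radius \<rho>'. The \<open>min\<close> repeats it
      beyond N, so that \<open>B i\<close> is fat for every i, as \<open>mean_osc_chain\<close>
      demands.\<close>
    define B where "B i = ball (p (min i N)) (if i < N then \<rho> else \<rho>')" for i
    have pos: "0 < \<rho>" "0 < \<rho>'"
      using \<rho> mult_pos_pos[OF \<eta>_pos t] by auto
    have fat: "fat (B i)" for i
      using pos by (simp add: B_def fat_ball)
    obtain n where n: "N = Suc n"
      using N(2) by (cases N) auto
    have step: "mean_osc f (B i) (B (Suc i)) \<le> ennreal ?K * local_osc \<Omega> \<theta> f M x t" if "i \<le> n" for i
    proof -
      have "C * dist a b / N \<le> C * (2 * t) / N"
        using ab C_ge_1 by (intro divide_right_mono mult_left_mono) auto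
      also have "\<dots> \<le> \<eta> * t"
        using N t \<eta>_pos by (simp add: field_simps)
      finally have 1: "dist (p i) (p (Suc i)) \<le> \<eta> * t"
        using p(6)[of i] that n by linarith
      have "C * dist a b \<le> C * (2 * t)"
        using ab C_ge_1 by (intro mult_left_mono) auto
      then have "dist (p i) x \<le> 2 * C * t + t"
        using p(5)[of i] that n ab dist_triangle[of "p i" x a] by linarith
      moreover have "\<eta> * t \<le> 1 * t"
        using \<eta>_small t by (intro mult_right_mono) auto
      ultimately have 2: "dist (p i) x + \<eta> * t \<le> M * t"
        by (simp add: M distrib_right)
      have 3: "\<kappa> * t \<le> bdist \<Omega> (p i)"
        using p(4)[of i] that n by (simp add: \<kappa>_def power2_eq_square)
      show ?thesis
        unfolding B_def using that n \<rho> p(3)[of i] 1 2 3 \<eta>_pos \<eta>_small \<kappa> C_ge_1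
        by (intro mean_osc_le_local_osc[OF f open_domain t \<eta>_pos assms(1,2)]) (auto simp: M)
    qed
    have "mean_osc f (ball a \<rho>) (ball b \<rho>') = mean_osc f (B 0) (B (Suc n))"
      using N p n by (simp add: B_def)
    also have "\<dots> \<le> (\<Sum>i\<le>n. mean_osc f (B i) (B (Suc i)))"
      by (intro mean_osc_chain f fat)
    also have "\<dots> \<le> (\<Sum>i\<le>n. ennreal ?K * local_osc \<Omega> \<theta> f M x t)"
      by (intro sum_mono step) auto
    also have "\<dots> = ennreal (N * ?K) * local_osc \<Omega> \<theta> f M x t"
      by (simp add: n ennreal_mult ennreal_of_nat_eq_real_of_nat mult_ac del: of_nat_Suc)
    finally show ?thesis .
  qed
  moreover have "0 < N * ?K"
    using N \<eta>_pos by (intro mult_pos_pos zero_less_power divide_pos_pos) auto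
  ultimately show ?thesis
    by blast
qed

text \<open>Balls of radius \<eta> 2^-k |x-y| approach x through points at distance 2^-k |x-y|/2
  from it, until the scale drops to \<theta> d(x) and \<open>end_osc\<close> takes over. The centre
  p of the coarsest ball is returned with its position, so that the chains of x and of y can be
  joined; it is chosen before f.\<close>

lemma dev_le_sum_local_osc:
  assumes "0 < \<theta>" "\<theta> \<le> 1" and \<eta>: "\<eta> = \<theta> / (64 * C\<^sup>2)" and M: "M = 2 * C + 2"
  shows "\<exists>K>0. \<forall>x\<in>\<Omega>. \<forall>y\<in>\<Omega>. x \<noteq> y \<longrightarrow> \<theta> * bdist \<Omega> x \<le> dist x y \<longrightarrow>
    (\<exists>p\<in>\<Omega>. dist p x \<le> dist x y / 2 \<and> dist x y / (4 * C) \<le> bdist \<Omega> p \<and>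
      (\<forall>f\<in>borel_measurable borel. dev f x (ball p (\<eta> * dist x y)) \<le>
         ennreal K * (end_osc \<Omega> \<theta> f x + (\<Sum>k. local_osc \<Omega> \<theta> f M x (dist x y / 2 ^ k)))))"
proof -
  obtain K where "0 < K" and harnack: "\<And>f x t a b \<rho> \<rho>'. f \<in> borel_measurable borel \<Longrightarrow> 0 < t \<Longrightarrow>
    a \<in> \<Omega> \<Longrightarrow> b \<in> \<Omega> \<Longrightarrow> t / (4 * C) \<le> bdist \<Omega> a \<Longrightarrow> t / (4 * C) \<le> bdist \<Omega> b \<Longrightarrow>
    dist a b \<le> 2 * t \<Longrightarrow> dist a x \<le> t \<Longrightarrow>
    \<rho> \<in> {\<eta> * t / 2..\<eta> * t} \<Longrightarrow> \<rho>' \<in> {\<eta> * t / 2..\<eta> * t} \<Longrightarrow>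
    mean_osc f (ball a \<rho>) (ball b \<rho>') \<le> ennreal K * local_osc \<Omega> \<theta> f M x t"
    using mean_osc_harnack[OF assms] by blast
  let ?K' = "1 / (unit_ball_vol (real DIM('a)) * (\<eta> * \<theta> / 2) ^ DIM('a))"
  have C2: "1 \<le> C\<^sup>2"
    using C_ge_1 by (rule one_le_power)
  have "\<theta> \<le> C\<^sup>2"
    using assms(2) C2 by linarith
  then have \<eta>_pos: "0 < \<eta>" and \<eta>_small: "\<eta> \<le> 1 / 64"
    unfolding \<eta> using assms(1) C_ge_1 by (auto simp: field_simps)
  have "\<exists>p\<in>\<Omega>. dist p x \<le> dist x y / 2 \<and> dist x y / (4 * C) \<le> bdist \<Omega> p \<and>
      (\<forall>f\<in>borel_measurable borel. dev f x (ball p (\<eta> * dist x y)) \<le>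
         ennreal (K + ?K') * (end_osc \<Omega> \<theta> f x + (\<Sum>k. local_osc \<Omega> \<theta> f M x (dist x y / 2 ^ k))))"
    if xy: "x \<in> \<Omega>" "y \<in> \<Omega>" "x \<noteq> y" "\<theta> * bdist \<Omega> x \<le> dist x y" for x y
  proof -
    define t where "t k = dist x y / 2 ^ k" for k :: nat
    have t_pos: "0 < t k" and t_Suc: "t (Suc k) = t k / 2" for k
      using xy by (auto simp: t_def)
    have "t k / 2 \<le> dist x y / 2" for k
      using xy by (simp add: t_def field_simps)
    then have "\<forall>k. \<exists>p\<in>\<Omega>. dist p x = t k / 2 \<and> t k / 2 \<le> C * bdist \<Omega> p"
      using t_pos by (intro allI exists_at_distance[OF xy(1,2)]) (auto simp: less_imp_le)
    then obtain p where p: "\<And>k. p k \<in> \<Omega>" "\<And>k. dist (p k) x = t k / 2"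
        "\<And>k. t k / 2 \<le> C * bdist \<Omega> (p k)"
      by metis
    have bd: "t k / (2 * C) \<le> bdist \<Omega> (p k)" for k
      using p(3)[of k] C_ge_1 by (simp add: field_simps)
    have bd': "t k / (4 * C) \<le> t k / (2 * C)" for k
      using t_pos[of k] C_ge_1 by (simp add: field_simps)
    have d: "0 < \<theta> * bdist \<Omega> x"
      using bdist_pos[OF open_domain frontier] xy assms by simp
    have ex: "\<exists>n. t n \<le> \<theta> * bdist \<Omega> x"
      using d xy real_arch_pow_inv[of "\<theta> * bdist \<Omega> x / dist x y" "1/2"]
      by (auto simp: t_def field_simps power_divide intro: less_imp_le)
    \<comment> \<open>The first scale at which the whole ball is visible from x.\<close>
    define n where "n = (LEAST n. t n \<le> \<theta> * bdist \<Omega> x)"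
    have n1: "t n \<le> \<theta> * bdist \<Omega> x"
      unfolding n_def using ex by (rule LeastI_ex)
    \<comment> \<open>The lower bound comes from minimality of n, and for n = 0 from the hypothesis
      on |x-y|. It bounds the last radius \<eta> t_n below by \<eta>\<theta>/2 times d(x), which
      explains \<open>?K'\<close>.\<close>
    have n2: "\<theta> * bdist \<Omega> x / 2 \<le> t n"
    proof (cases n)
      case 0
      then show ?thesis
        using xy(4) d by (simp add: t_def)
    next
      case (Suc m)
      then have "\<theta> * bdist \<Omega> x < t m"
        using not_less_Least[of m "\<lambda>n. t n \<le> \<theta> * bdist \<Omega> x"] by (simp add: n_def)
      then show ?thesis
        by (simp add: Suc t_Suc)
    qed
    define B where "B k = ball (p k) (\<eta> * t k)" for k
    have fat: "fat (B k)" for k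
      using \<eta>_pos t_pos by (simp add: B_def fat_ball)
    \<comment> \<open>Both balls are measured at the coarser scale t_k. The finer one has radius
      \<eta> t_k/2 and boundary distance at least t_(k+1)/(2C) = t_k/(4C); hence the range of radii
      and the 4C in \<open>mean_osc_harnack\<close>.\<close>
    have step: "mean_osc f (B (Suc k)) (B k) \<le> ennreal K * local_osc \<Omega> \<theta> f M x (t k)"
      if "f \<in> borel_measurable borel" for f k
    proof -
      have "dist (p (Suc k)) (p k) \<le> t k / 4 + t k / 2"
        using dist_triangle2[of "p (Suc k)" "p k" x] p(2) by (simp add: t_Suc)
      moreover have "dist (p (Suc k)) x \<le> t k"
        using p(2)[of "Suc k"] t_pos[of k] by (simp add: t_Suc)
      ultimately show ?thesis
        unfolding B_def using that p(1) t_pos[of k] bd[of "Suc k"] bd[of k] bd'[of k] \<eta>_pos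
        by (intro harnack) (auto simp: t_Suc)
    qed
    have "ball (p n) (\<eta> * t n) \<subseteq> ball x (\<theta> * bdist \<Omega> x)"
    proof
      fix z assume "z \<in> ball (p n) (\<eta> * t n)"
      then have "dist x z < t n / 2 + \<eta> * t n"
        using dist_triangle[of x z "p n"] p(2)[of n] by (simp add: dist_commute)
      moreover have "\<eta> * t n \<le> 1 / 64 * t n"
        using t_pos[of n] \<eta>_small by (intro mult_right_mono) auto
      ultimately have "dist x z < t n"
        using t_pos[of n] by linarith
      then show "z \<in> ball x (\<theta> * bdist \<Omega> x)"
        using n1 by simp
    qed
    moreover have "\<eta> * \<theta> / 2 * bdist \<Omega> x \<le> \<eta> * t n"
      using mult_left_mono[OF n2, of \<eta>] \<eta>_pos by simp
    ultimately have "dev f x (B n) \<le> ennreal ?K' * end_osc \<Omega> \<theta> f x"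
      if "f \<in> borel_measurable borel" for f
      unfolding B_def using \<eta>_pos assms(1,2) that xy by (intro dev_le_end_osc open_domain frontier) auto
    then have "dev f x (B 0) \<le> ennreal ?K' * end_osc \<Omega> \<theta> f x +
        (\<Sum>k<n. ennreal K * local_osc \<Omega> \<theta> f M x (t k))" if "f \<in> borel_measurable borel" for f
      using that by (intro order_trans[OF dev_chain[of f B x n]] fat add_mono sum_mono step)
    \<comment> \<open>Summing over all scales removes the index n, which depends on x and y.\<close>
    also have "\<dots> f \<le> ennreal ?K' * end_osc \<Omega> \<theta> f x +
        ennreal K * (\<Sum>k. local_osc \<Omega> \<theta> f M x (t k))" for f
      unfolding sum_distrib_left[symmetric]
      by (intro add_left_mono mult_left_mono sum_le_suminf summableI) auto
    also have "\<dots> f \<le> ennreal (K + ?K') * end_osc \<Omega> \<theta> f x +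
        ennreal (K + ?K') * (\<Sum>k. local_osc \<Omega> \<theta> f M x (t k))" for f
      using \<open>0 < K\<close> \<eta>_pos assms(1) by (intro add_mono mult_right_mono ennreal_leI) auto
    finally have "dev f x (B 0) \<le> ennreal (K + ?K') *
        (end_osc \<Omega> \<theta> f x + (\<Sum>k. local_osc \<Omega> \<theta> f M x (t k)))" if "f \<in> borel_measurable borel" for f
      using that by (simp add: distrib_left)
    then show ?thesis
      using p(1)[of 0] p(2)[of 0] bd[of 0] bd'[of 0]
      by (intro bexI[of _ "p 0"]) (auto simp: B_def t_def)
  qed
  moreover have "0 < K + ?K'"
    using \<open>0 < K\<close> \<eta>_pos assms(1) by (intro add_pos_nonneg) auto
  ultimately show ?thesis
    by blast
qed

text \<open>The coarsest balls of x and of y have the same radius, and their centres are at most r/2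
  + r + r/2 = 2r apart, with r = |x-y|. One Harnack chain at scale r joins them; its cost is charged
  to y.\<close>

lemma pointwise_estimate:
  assumes "0 < \<theta>" "\<theta> \<le> 1"
  shows "\<exists>K>0. \<exists>M>0. \<forall>f\<in>borel_measurable borel. \<forall>x\<in>\<Omega>. \<forall>y\<in>\<Omega>. x \<noteq> y \<longrightarrow>
    \<theta> * bdist \<Omega> x \<le> dist x y \<longrightarrow> \<theta> * bdist \<Omega> y \<le> dist x y \<longrightarrow>
    ennreal \<bar>f x - f y\<bar> \<le> ennreal K *
      ((end_osc \<Omega> \<theta> f x + (\<Sum>k. local_osc \<Omega> \<theta> f M x (dist x y / 2 ^ k))) +
       (end_osc \<Omega> \<theta> f y + (\<Sum>k. local_osc \<Omega> \<theta> f M y (dist x y / 2 ^ k))))"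
proof -
  define \<eta> where "\<eta> = \<theta> / (64 * C\<^sup>2)"
  define M where "M = 2 * C + 2"
  have \<eta>_pos: "0 < \<eta>" and M_pos: "0 < M"
    using assms C_ge_1 by (auto simp: \<eta>_def M_def)
  let ?I = "\<lambda>f x t. \<Sum>k. local_osc \<Omega> \<theta> f M x (t / 2 ^ k)"
  obtain K1 where "0 < K1" and harnack: "\<And>f x t a b \<rho> \<rho>'. f \<in> borel_measurable borel \<Longrightarrow> 0 < t \<Longrightarrow>
    a \<in> \<Omega> \<Longrightarrow> b \<in> \<Omega> \<Longrightarrow> t / (4 * C) \<le> bdist \<Omega> a \<Longrightarrow> t / (4 * C) \<le> bdist \<Omega> b \<Longrightarrow>
    dist a b \<le> 2 * t \<Longrightarrow> dist a x \<le> t \<Longrightarrow>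
    \<rho> \<in> {\<eta> * t / 2..\<eta> * t} \<Longrightarrow> \<rho>' \<in> {\<eta> * t / 2..\<eta> * t} \<Longrightarrow>
    mean_osc f (ball a \<rho>) (ball b \<rho>') \<le> ennreal K1 * local_osc \<Omega> \<theta> f M x t"
    using mean_osc_harnack[OF assms \<eta>_def M_def] by blast
  obtain K2 where "0 < K2" and half: "\<And>x y. x \<in> \<Omega> \<Longrightarrow> y \<in> \<Omega> \<Longrightarrow> x \<noteq> y \<Longrightarrow> \<theta> * bdist \<Omega> x \<le> dist x y \<Longrightarrow>
    (\<exists>p\<in>\<Omega>. dist p x \<le> dist x y / 2 \<and> dist x y / (4 * C) \<le> bdist \<Omega> p \<and>
      (\<forall>f\<in>borel_measurable borel. dev f x (ball p (\<eta> * dist x y)) \<le>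
         ennreal K2 * (end_osc \<Omega> \<theta> f x + ?I f x (dist x y))))"
    using dev_le_sum_local_osc[OF assms \<eta>_def M_def] by blast
  have "ennreal \<bar>f x - f y\<bar> \<le> ennreal (K1 + K2) *
      ((end_osc \<Omega> \<theta> f x + ?I f x (dist x y)) + (end_osc \<Omega> \<theta> f y + ?I f y (dist x y)))"
    if f: "f \<in> borel_measurable borel" and xy: "x \<in> \<Omega>" "y \<in> \<Omega>" "x \<noteq> y"
      "\<theta> * bdist \<Omega> x \<le> dist x y" "\<theta> * bdist \<Omega> y \<le> dist x y" for f x y
  proof -
    let ?r = "dist x y"
    obtain p where p: "p \<in> \<Omega>" "dist p x \<le> ?r / 2" "?r / (4 * C) \<le> bdist \<Omega> p"
      "dev f x (ball p (\<eta> * ?r)) \<le> ennreal K2 * (end_osc \<Omega> \<theta> f x + ?I f x ?r)"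
      using half[OF xy(1-4)] f by blast
    obtain q where q: "q \<in> \<Omega>" "dist q y \<le> ?r / 2" "?r / (4 * C) \<le> bdist \<Omega> q"
      "dev f y (ball q (\<eta> * ?r)) \<le> ennreal K2 * (end_osc \<Omega> \<theta> f y + ?I f y ?r)"
      using half[of y x] xy f unfolding dist_commute[of y x] by blast
    have r: "0 < ?r" "0 < \<eta> * ?r"
      using xy \<eta>_pos by auto
    have "dist q p \<le> 2 * ?r"
      using p(2) q(2) dist_triangle[of q p y] dist_triangle[of y p x] dist_commute[of y x] dist_commute[of x p]
      by linarith
    then have "mean_osc f (ball q (\<eta> * ?r)) (ball p (\<eta> * ?r)) \<le> ennreal K1 * local_osc \<Omega> \<theta> f M y ?r"
      using p q r by (intro harnack f) (auto intro: order_trans[of _ "?r / 2"])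
    \<comment> \<open>The scale r is the term k = 0 of the series.\<close>
    also have "\<dots> \<le> ennreal K1 * ?I f y ?r"
      using sum_le_suminf[of "\<lambda>k. local_osc \<Omega> \<theta> f M y (?r / 2 ^ k)" "{0}"]
      by (intro mult_left_mono) auto
    finally have m: "mean_osc f (ball q (\<eta> * ?r)) (ball p (\<eta> * ?r)) \<le> ennreal K1 * (end_osc \<Omega> \<theta> f y + ?I f y ?r)"
      by (rule order_trans) (auto intro: mult_left_mono)
    have fat: "fat (ball p (\<eta> * ?r))" "fat (ball q (\<eta> * ?r))"
      using r by (auto simp: fat_ball)
    have "ennreal \<bar>f x - f y\<bar> \<le> dev f x (ball p (\<eta> * ?r)) + dev f y (ball p (\<eta> * ?r))"
      by (intro abs_diff_le_dev f fat)
    also have "\<dots> \<le> dev f x (ball p (\<eta> * ?r)) + (dev f y (ball q (\<eta> * ?r)) +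
        mean_osc f (ball q (\<eta> * ?r)) (ball p (\<eta> * ?r)))"
      by (intro add_left_mono dev_triangle f fat)
    also have "\<dots> \<le> ennreal K2 * (end_osc \<Omega> \<theta> f x + ?I f x ?r) +
        (ennreal K2 * (end_osc \<Omega> \<theta> f y + ?I f y ?r) + ennreal K1 * (end_osc \<Omega> \<theta> f y + ?I f y ?r))"
      by (intro add_mono p q m)
    also have "\<dots> \<le> ennreal (K1 + K2) * (end_osc \<Omega> \<theta> f x + ?I f x ?r) +
        ennreal (K1 + K2) * (end_osc \<Omega> \<theta> f y + ?I f y ?r)"
      unfolding distrib_right[symmetric] using \<open>0 < K1\<close> \<open>0 < K2\<close>
      by (intro add_mono mult_right_mono) (auto simp: add.commute ennreal_leI simp flip: ennreal_plus)
    finally show ?thesis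
      by (simp add: distrib_left)
  qed
  moreover have "0 < K1 + K2"
    using \<open>0 < K1\<close> \<open>0 < K2\<close> by simp
  ultimately show ?thesis
    using M_pos by (intro exI[of _ "K1 + K2"] exI[of _ M] conjI) auto
qed

end

section \<open>Weights\<close>

text \<open>The pointwise form $Mw \le Aw$ of the $A_1$ condition, with centred balls.\<close>

definition maximal_le :: "real \<Rightarrow> ('a::euclidean_space \<Rightarrow> real) \<Rightarrow> 'a \<Rightarrow> bool" where
  "maximal_le A w y \<longleftrightarrow>
     (\<forall>R>0. (\<integral>\<^sup>+z\<in>ball y R. ennreal (w z) \<partial>lborel) \<le> ennreal (A * R ^ DIM('a) * w y))"

text \<open>Nonnegativity is required everywhere, so that products under \<open>ennreal\<close>
  split without exceptional points; the maximal bound keeps its null set.\<close>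

definition borel_A1 :: "real \<Rightarrow> ('a::euclidean_space \<Rightarrow> real) \<Rightarrow> bool" where
  "borel_A1 A w \<longleftrightarrow> 0 \<le> A \<and> w \<in> borel_measurable borel \<and> (\<forall>x. 0 \<le> w x) \<and> (AE y in lborel. maximal_le A w y)"

definition weighted_kernel ::
  "real \<Rightarrow> ('a::euclidean_space \<Rightarrow> real) \<Rightarrow> ('a \<Rightarrow> real) \<Rightarrow> 'a \<Rightarrow> 'a \<Rightarrow> ennreal" where
  "weighted_kernel s w v x y = ennreal (dist x y powr - (real DIM('a) + s) * (w x * v y))"

text \<open>One half of the truncated seminorm: the first weight sits at the centre of the ball, the
  second at the other point.\<close>

definition osc_energy ::
  "real \<Rightarrow> 'a::euclidean_space set \<Rightarrow> real \<Rightarrow> ('a \<Rightarrow> real) \<Rightarrow> ('a \<Rightarrow> real) \<Rightarrow> ('a \<Rightarrow> real) \<Rightarrow> ennreal" where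
  "osc_energy s \<Omega> \<theta> f w v =
     (\<integral>\<^sup>+x. (\<integral>\<^sup>+y. osc \<Omega> \<theta> f x y * weighted_kernel s w v x y \<partial>lborel) \<partial>lborel)"

lemma weighted_kernel_commute: "weighted_kernel s w v x y = weighted_kernel s v w y x"
  by (simp add: weighted_kernel_def dist_commute mult.commute)

lemma borel_measurable_weighted_kernel [measurable]:
  assumes [measurable]: "w \<in> borel_measurable borel" "v \<in> borel_measurable borel"
    "g \<in> borel_measurable M" "h \<in> borel_measurable M"
  shows "(\<lambda>x. weighted_kernel s w v (g x) (h x)) \<in> borel_measurable M"
  unfolding weighted_kernel_def by measurable

section \<open>Tails of weights\<close>

lemma suminf_ennreal_geometric:
  assumes "0 < \<sigma>" "0 \<le> c"
  shows "(\<Sum>j. ennreal (c * (2 ^ j) powr - \<sigma>)) = ennreal (c / (1 - 2 powr - \<sigma>))"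
proof (rule suminf_ennreal_eq)
  have "2 powr - \<sigma> < 2 powr 0"
    using assms(1) by (intro powr_less_mono) auto
  then have "(\<lambda>j. c * (2 powr - \<sigma>) ^ j) sums (c * (1 / (1 - 2 powr - \<sigma>)))"
    by (intro sums_mult geometric_sums) auto
  moreover have "(2 powr - \<sigma>) ^ j = (2 ^ j) powr - \<sigma>" for j :: nat
    by (simp add: powr_powr powr_power mult.commute flip: powr_realpow)
  ultimately show "(\<lambda>j. c * (2 ^ j) powr - \<sigma>) sums (c / (1 - 2 powr - \<sigma>))"
    by simp
qed (use assms in auto)

text \<open>A single term suffices, that of the least j with d < 2 (2^j \<rho>): then 2^j \<rho> is
  at most d, or equals \<rho> when j = 0. The cut-off on d turns each term into an integral over a
  ball.\<close>

lemma max_powr_le_dyadic_sum: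
  assumes "0 < \<rho>" "0 \<le> p"
  shows "ennreal (max d \<rho> powr - p) \<le>
    (\<Sum>j. ennreal ((2 ^ j * \<rho>) powr - p) * (if d < 2 * (2 ^ j * \<rho>) then 1 else 0))"
proof -
  have "\<exists>j::nat. d < 2 * (2 ^ j * \<rho>)"
    using assms real_arch_pow[of 2 "d / (2 * \<rho>)"] by (auto simp: field_simps)
  then obtain j :: nat where j: "d < 2 * (2 ^ j * \<rho>)" "\<And>i. i < j \<Longrightarrow> 2 * (2 ^ i * \<rho>) \<le> d"
    using exists_least_iff[of "\<lambda>j. d < 2 * (2 ^ j * \<rho>)"] by (auto simp: not_less)
  have "2 ^ j * \<rho> \<le> max d \<rho>"
    using j(2)[of "j - 1"] by (cases j) auto
  then have "max d \<rho> powr - p \<le> (2 ^ j * \<rho>) powr - p"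
    using assms by (intro powr_mono2') auto
  also have "ennreal \<dots> = (\<Sum>j\<in>{j}. ennreal ((2 ^ j * \<rho>) powr - p) * (if d < 2 * (2 ^ j * \<rho>) then 1 else 0))"
    using j by simp
  also have "\<dots> \<le> (\<Sum>j. ennreal ((2 ^ j * \<rho>) powr - p) * (if d < 2 * (2 ^ j * \<rho>) then 1 else 0))"
    by (intro sum_le_suminf summableI) auto
  finally show ?thesis
    by (simp add: ennreal_leI)
qed

text \<open>The dyadic ball of radius 2 (2^j \<rho>) about a lies in the ball of radius (2+M) 2^j
  \<rho> about z. The maximal bound there gives (2^j \<rho>)^d w(z), and the kernel leaves (2^j
  \<rho>)^-\<sigma>, a geometric series. Separating z from a matters: a is an arbitrary centre,
  while the bound holds at almost every z.\<close>

lemma maximal_le_tail: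
  fixes w :: "'a::euclidean_space \<Rightarrow> real"
  assumes [measurable]: "w \<in> borel_measurable borel" and w: "\<And>x. 0 \<le> w x"
    and "0 \<le> A" "0 < \<sigma>" "0 \<le> M"
  shows "\<exists>K\<ge>0. \<forall>z a \<rho>. maximal_le A w z \<longrightarrow> 0 < \<rho> \<longrightarrow> dist z a \<le> M * \<rho> \<longrightarrow>
    (\<integral>\<^sup>+y. ennreal (w y * max (dist y a) \<rho> powr - (real DIM('a) + \<sigma>)) \<partial>lborel)
      \<le> ennreal (K * \<rho> powr - \<sigma> * w z)"
proof (intro exI conjI allI impI)
  let ?n = "DIM('a)"
  let ?K = "A * (2 + M) ^ ?n / (1 - 2 powr - \<sigma>)"
  have "2 powr - \<sigma> < 2 powr 0"
    using assms by (intro powr_less_mono) auto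
  then show "0 \<le> ?K"
    using assms by auto
  fix z a :: 'a and \<rho> :: real
  assume z: "maximal_le A w z" and \<rho>: "0 < \<rho>" and za: "dist z a \<le> M * \<rho>"
  define p where "p = real ?n + \<sigma>"
  have p: "0 \<le> p"
    using assms by (simp add: p_def)
  have term_le: "(\<integral>\<^sup>+y. ennreal (w y) * (ennreal ((2 ^ j * \<rho>) powr - p) *
      (if dist y a < 2 * (2 ^ j * \<rho>) then 1 else 0)) \<partial>lborel) \<le>
      ennreal (A * (2 + M) ^ ?n * \<rho> powr - \<sigma> * w z * (2 ^ j) powr - \<sigma>)" for j :: nat
  proof -
    let ?r = "2 ^ j * \<rho>"
    have "M * \<rho> \<le> M * ?r"
      using \<rho> assms by (intro mult_left_mono) auto
    then have sub: "dist z y < (2 + M) * ?r" if "dist y a < 2 * ?r" for y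
      using that za dist_triangle2[of z y a] by (simp add: distrib_right)
    have "(\<integral>\<^sup>+y. ennreal (w y) * (ennreal (?r powr - p) * (if dist y a < 2 * ?r then 1 else 0)) \<partial>lborel)
        \<le> (\<integral>\<^sup>+y. (ennreal (w y) * indicator (ball z ((2 + M) * ?r)) y) * ennreal (?r powr - p) \<partial>lborel)"
      using sub by (intro nn_integral_mono) (auto simp: indicator_def mult_ac)
    also have "\<dots> = (\<integral>\<^sup>+y\<in>ball z ((2 + M) * ?r). ennreal (w y) \<partial>lborel) * ennreal (?r powr - p)"
      by (intro nn_integral_multc borel_measurable_times_ennreal borel_measurable_indicator) auto
    also have "\<dots> \<le> ennreal (A * ((2 + M) * ?r) ^ ?n * w z) * ennreal (?r powr - p)"
      using z \<rho> assms unfolding maximal_le_def by (intro mult_right_mono) auto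
    also have "\<dots> = ennreal (A * (2 + M) ^ ?n * \<rho> powr - \<sigma> * w z * (2 ^ j) powr - \<sigma>)"
    proof -
      have "z ^ ?n * z powr - p = z powr - \<sigma>" if "0 < z" for z
        using that by (simp add: p_def powr_realpow[symmetric] powr_add[symmetric])
      then have "?r ^ ?n * ?r powr - p = ?r powr - \<sigma>"
        using \<rho> by simp
      also have "\<dots> = \<rho> powr - \<sigma> * (2 ^ j) powr - \<sigma>"
        using \<rho> by (simp add: powr_mult)
      finally have eq: "A * ((2 + M) * ?r) ^ ?n * w z * ?r powr - p =
          A * (2 + M) ^ ?n * \<rho> powr - \<sigma> * w z * (2 ^ j) powr - \<sigma>"
        by (simp add: power_mult_distrib mult_ac)
      have "0 \<le> A * ((2 + M) * ?r) ^ ?n * w z"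
        using assms w \<rho> by simp
      then show ?thesis
        by (simp only: ennreal_mult[symmetric] powr_ge_zero eq)
    qed
    finally show ?thesis .
  qed
  have "(\<integral>\<^sup>+y. ennreal (w y * max (dist y a) \<rho> powr - p) \<partial>lborel) \<le>
     (\<integral>\<^sup>+y. (\<Sum>j. ennreal (w y) * (ennreal ((2 ^ j * \<rho>) powr - p) *
      (if dist y a < 2 * (2 ^ j * \<rho>) then 1 else 0))) \<partial>lborel)"
    using w \<rho> p unfolding ennreal_suminf_cmult
    by (intro nn_integral_mono) (auto simp: ennreal_mult intro!: mult_left_mono max_powr_le_dyadic_sum)
  also have "\<dots> = (\<Sum>j. \<integral>\<^sup>+y. ennreal (w y) * (ennreal ((2 ^ j * \<rho>) powr - p) *
      (if dist y a < 2 * (2 ^ j * \<rho>) then 1 else 0)) \<partial>lborel)"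
    by (intro nn_integral_suminf) measurable
  also have "\<dots> \<le> (\<Sum>j. ennreal (A * (2 + M) ^ ?n * \<rho> powr - \<sigma> * w z * (2 ^ j) powr - \<sigma>))"
    by (intro suminf_le summableI term_le)
  also have "\<dots> = ennreal (?K * \<rho> powr - \<sigma> * w z)"
    using assms w by (subst suminf_ennreal_geometric) (auto simp: mult_ac)
  finally show "(\<integral>\<^sup>+y. ennreal (w y * max (dist y a) \<rho> powr - (real ?n + \<sigma>)) \<partial>lborel)
      \<le> ennreal (?K * \<rho> powr - \<sigma> * w z)"
    by (simp add: p_def)
qed

section \<open>Integrating the pointwise estimate\<close>

text \<open>The tail over |x-y| >= \<theta> d(x) is bounded by a multiple of (\<theta> d(x))^-s w(z)
  for almost every z in the ball visible from x. Together with the normalisation of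
  \<open>end_osc\<close> this is \<theta>^-s d(x)^(-d-s) w(z), with d in the exponent the dimension,
  and |x-z| < d(x) turns it into the kernel at (x,z).\<close>

lemma end_osc_energy_le:
  fixes \<Omega> :: "'a::euclidean_space set"
  assumes w: "borel_A1 A w" and v: "v \<in> borel_measurable borel" "\<And>x. 0 \<le> v x"
    and \<Omega>: "open \<Omega>" "frontier \<Omega> \<noteq> {}" and "0 < s" "0 < \<theta>" "\<theta> \<le> 1"
  shows "\<exists>K\<ge>0. \<forall>f\<in>borel_measurable borel.
    (\<integral>\<^sup>+x. (\<integral>\<^sup>+y. (if x \<in> \<Omega> \<and> \<theta> * bdist \<Omega> x \<le> dist x y
        then end_osc \<Omega> \<theta> f x * weighted_kernel s v w x y else 0) \<partial>lborel) \<partial>lborel)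
      \<le> ennreal K * osc_energy s \<Omega> \<theta> f v w"
proof -
  let ?n = "DIM('a)"
  note [measurable] = v(1)
  have [measurable]: "w \<in> borel_measurable borel" "\<Omega> \<in> sets borel" and w0: "\<And>x. 0 \<le> w x"
    and max_le: "AE z in lborel. maximal_le A w z" and "0 \<le> A"
    using w \<Omega> by (auto simp: borel_A1_def)
  obtain K where "0 \<le> K" and tail: "\<And>z a \<rho>. maximal_le A w z \<Longrightarrow> 0 < \<rho> \<Longrightarrow> dist z a \<le> 1 * \<rho> \<Longrightarrow>
      (\<integral>\<^sup>+y. ennreal (w y * max (dist y a) \<rho> powr - (real ?n + s)) \<partial>lborel)
      \<le> ennreal (K * \<rho> powr - s * w z)"
    using maximal_le_tail[of w A s 1] \<open>0 < s\<close> \<open>0 \<le> A\<close> w0 by force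
  have kernel: "weighted_kernel s v w x y =
      ennreal (v x) * ennreal (w y * dist y x powr - (real ?n + s))" for x y
    using v(2) w0 by (simp add: weighted_kernel_def dist_commute mult_ac flip: ennreal_mult)
  have "(\<integral>\<^sup>+y. (if x \<in> \<Omega> \<and> \<theta> * bdist \<Omega> x \<le> dist x y
        then end_osc \<Omega> \<theta> f x * weighted_kernel s v w x y else 0) \<partial>lborel) \<le>
      ennreal (K * \<theta> powr - s) * (\<integral>\<^sup>+z. osc \<Omega> \<theta> f x z * weighted_kernel s v w x z \<partial>lborel)"
    if f[measurable]: "f \<in> borel_measurable borel" for f x
  proof (cases "x \<in> \<Omega>")
    case True
    let ?d = "bdist \<Omega> x"
    let ?W = "\<integral>\<^sup>+y. ennreal (w y * max (dist y x) (\<theta> * ?d) powr - (real ?n + s)) \<partial>lborel"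
    have d: "0 < ?d"
      using \<Omega> True by (intro bdist_pos)
    have "(\<integral>\<^sup>+y. (if x \<in> \<Omega> \<and> \<theta> * ?d \<le> dist x y
        then end_osc \<Omega> \<theta> f x * weighted_kernel s v w x y else 0) \<partial>lborel) \<le>
      (\<integral>\<^sup>+y. (end_osc \<Omega> \<theta> f x * ennreal (v x)) *
        ennreal (w y * max (dist y x) (\<theta> * ?d) powr - (real ?n + s)) \<partial>lborel)"
      using kernel[of x] by (intro nn_integral_mono) (auto simp: mult.assoc max_def dist_commute)
    also have "\<dots> = (end_osc \<Omega> \<theta> f x * ennreal (v x)) * ?W"
      by (intro nn_integral_cmult) measurable
    \<comment> \<open>The tail \<open>?W\<close> goes under the integral over z, where it may be
      bounded by a different multiple of w(z) at each z.\<close>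
    also have "\<dots> = (\<integral>\<^sup>+z. osc \<Omega> \<theta> f x z * (ennreal (?d powr - real ?n) * ennreal (v x) * ?W) \<partial>lborel)"
      unfolding end_osc_def by (subst nn_integral_multc) (auto simp: mult_ac)
    also have "\<dots> \<le> (\<integral>\<^sup>+z. ennreal (K * \<theta> powr - s) * (osc \<Omega> \<theta> f x z * weighted_kernel s v w x z) \<partial>lborel)"
    proof (rule nn_integral_mono_AE, use max_le in eventually_elim)
      fix z assume z: "maximal_le A w z"
      show "osc \<Omega> \<theta> f x z * (ennreal (?d powr - real ?n) * ennreal (v x) * ?W) \<le>
          ennreal (K * \<theta> powr - s) * (osc \<Omega> \<theta> f x z * weighted_kernel s v w x z)"
      proof (cases "dist x z < \<theta> * ?d \<and> x \<noteq> z")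
        case True
        have "?W \<le> ennreal (K * (\<theta> * ?d) powr - s * w z)"
          using True d assms by (intro tail z) (auto simp: dist_commute)
        then have "ennreal (?d powr - real ?n) * ennreal (v x) * ?W \<le>
            ennreal (?d powr - real ?n * v x * (K * (\<theta> * ?d) powr - s * w z))"
          using \<open>0 \<le> K\<close> v w0 by (simp add: ennreal_mult mult_left_mono)
        also have "\<dots> \<le> ennreal (K * \<theta> powr - s * (dist x z powr - (real ?n + s) * (v x * w z)))"
        proof (rule ennreal_leI)
          have "\<theta> * ?d \<le> 1 * ?d"
            using assms d by (intro mult_right_mono) auto
          then have "?d powr - (real ?n + s) \<le> dist x z powr - (real ?n + s)"
            using True assms by (intro powr_mono2') auto
          then have "K * \<theta> powr - s * (v x * w z) * ?d powr - (real ?n + s) \<le>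
              K * \<theta> powr - s * (v x * w z) * dist x z powr - (real ?n + s)"
            using \<open>0 \<le> K\<close> v w0 by (intro mult_left_mono) auto
          moreover have "?d powr - real ?n * (\<theta> * ?d) powr - s = \<theta> powr - s * ?d powr - (real ?n + s)"
            using d assms by (simp add: powr_mult powr_add[symmetric] algebra_simps)
          ultimately show "?d powr - real ?n * v x * (K * (\<theta> * ?d) powr - s * w z) \<le>
              K * \<theta> powr - s * (dist x z powr - (real ?n + s) * (v x * w z))"
            by (simp add: mult_ac)
        qed
        finally show ?thesis
          using \<open>0 \<le> K\<close> v w0
          by (auto simp: weighted_kernel_def ennreal_mult mult_ac dest: mult_left_mono[of _ _ "osc \<Omega> \<theta> f x z"])
      qed (auto simp: osc_def)
    qed
    also have "\<dots> = ennreal (K * \<theta> powr - s) * (\<integral>\<^sup>+z. osc \<Omega> \<theta> f x z * weighted_kernel s v w x z \<partial>lborel)"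
      by (intro nn_integral_cmult) measurable
    finally show ?thesis .
  qed simp
  then have "(\<integral>\<^sup>+x. (\<integral>\<^sup>+y. (if x \<in> \<Omega> \<and> \<theta> * bdist \<Omega> x \<le> dist x y
        then end_osc \<Omega> \<theta> f x * weighted_kernel s v w x y else 0) \<partial>lborel) \<partial>lborel)
      \<le> ennreal (K * \<theta> powr - s) * osc_energy s \<Omega> \<theta> f v w"
    if f[measurable]: "f \<in> borel_measurable borel" for f
    unfolding osc_energy_def using f
    by (subst nn_integral_cmult[symmetric]) (auto intro!: nn_integral_mono)
  then show ?thesis
    using \<open>0 \<le> K\<close> by (intro exI[of _ "K * \<theta> powr - s"]) auto
qed

lemma nn_integral_swap_pairs:
  fixes H :: "'a::euclidean_space \<times> 'a \<times> 'a \<times> 'a \<Rightarrow> ennreal"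
  assumes [measurable]: "H \<in> borel_measurable (borel \<Otimes>\<^sub>M borel \<Otimes>\<^sub>M borel \<Otimes>\<^sub>M borel)"
  shows "(\<integral>\<^sup>+x. (\<integral>\<^sup>+y. (\<integral>\<^sup>+u. (\<integral>\<^sup>+u'. H (x, y, u, u') \<partial>lborel) \<partial>lborel) \<partial>lborel) \<partial>lborel) =
    (\<integral>\<^sup>+u. (\<integral>\<^sup>+u'. (\<integral>\<^sup>+x. (\<integral>\<^sup>+y. H (x, y, u, u') \<partial>lborel) \<partial>lborel) \<partial>lborel) \<partial>lborel)"
proof -
  have "(\<integral>\<^sup>+x. (\<integral>\<^sup>+y. (\<integral>\<^sup>+u. (\<integral>\<^sup>+u'. H (x, y, u, u') \<partial>lborel) \<partial>lborel) \<partial>lborel) \<partial>lborel) =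
      (\<integral>\<^sup>+x. (\<integral>\<^sup>+u. (\<integral>\<^sup>+y. (\<integral>\<^sup>+u'. H (x, y, u, u') \<partial>lborel) \<partial>lborel) \<partial>lborel) \<partial>lborel)"
    by (intro nn_integral_cong lborel_pair.Fubini') measurable
  also have "\<dots> = (\<integral>\<^sup>+x. (\<integral>\<^sup>+u. (\<integral>\<^sup>+u'. (\<integral>\<^sup>+y. H (x, y, u, u') \<partial>lborel) \<partial>lborel) \<partial>lborel) \<partial>lborel)"
    by (intro nn_integral_cong lborel_pair.Fubini') measurable
  also have "\<dots> = (\<integral>\<^sup>+u. (\<integral>\<^sup>+x. (\<integral>\<^sup>+u'. (\<integral>\<^sup>+y. H (x, y, u, u') \<partial>lborel) \<partial>lborel) \<partial>lborel) \<partial>lborel)"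
    by (intro lborel_pair.Fubini') measurable
  also have "\<dots> = (\<integral>\<^sup>+u. (\<integral>\<^sup>+u'. (\<integral>\<^sup>+x. (\<integral>\<^sup>+y. H (x, y, u, u') \<partial>lborel) \<partial>lborel) \<partial>lborel) \<partial>lborel)"
    by (intro nn_integral_cong lborel_pair.Fubini') measurable
  finally show ?thesis .
qed

text \<open>After Tonelli, u and u' are fixed and two tails are taken. Integrating y uses the tail
  about x evaluated at u, with \<sigma> = 2d+s; integrating x uses the tail about u evaluated at u',
  with \<sigma> = d+s. The bounds hold for almost every u and then almost every u'.\<close>

lemma local_osc_energy_le_dyadic:
  fixes \<Omega> :: "'a::euclidean_space set"
  assumes w: "borel_A1 A w" and v: "borel_A1 A' v" and \<Omega>: "open \<Omega>" and "0 < s" "0 < M"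
  shows "\<exists>K\<ge>0. \<forall>f\<in>borel_measurable borel. \<forall>k::nat.
    (\<integral>\<^sup>+x. (\<integral>\<^sup>+y. weighted_kernel s v w x y * local_osc \<Omega> \<theta> f M x (dist x y / 2 ^ k) \<partial>lborel) \<partial>lborel)
      \<le> ennreal (K * (2 ^ k) powr - s) * osc_energy s \<Omega> \<theta> f w v"
proof -
  let ?n = "DIM('a)"
  have [measurable]: "w \<in> borel_measurable borel" "v \<in> borel_measurable borel" "\<Omega> \<in> sets borel"
    and w0: "\<And>x. 0 \<le> w x" and v0: "\<And>x. 0 \<le> v x" and "0 \<le> A" "0 \<le> A'"
    and max_le: "AE z in lborel. maximal_le A w z" "AE z in lborel. maximal_le A' v z"
    using w v \<Omega> by (auto simp: borel_A1_def)
  obtain K1 where "0 \<le> K1" and tail1: "\<And>z a \<rho>. maximal_le A w z \<Longrightarrow> 0 < \<rho> \<Longrightarrow> dist z a \<le> M * \<rho> \<Longrightarrow>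
      (\<integral>\<^sup>+y. ennreal (w y * max (dist y a) \<rho> powr - (real ?n + (2 * real ?n + s))) \<partial>lborel)
      \<le> ennreal (K1 * \<rho> powr - (2 * real ?n + s) * w z)"
    using maximal_le_tail[of w A "2 * real ?n + s" M] \<open>0 < s\<close> \<open>0 < M\<close> \<open>0 \<le> A\<close> w0 by force
  obtain K2 where "0 \<le> K2" and tail2: "\<And>z a \<rho>. maximal_le A' v z \<Longrightarrow> 0 < \<rho> \<Longrightarrow> dist z a \<le> 1 * \<rho> \<Longrightarrow>
      (\<integral>\<^sup>+x. ennreal (v x * max (dist x a) \<rho> powr - (real ?n + (real ?n + s))) \<partial>lborel)
      \<le> ennreal (K2 * \<rho> powr - (real ?n + s) * v z)"
    using maximal_le_tail[of v A' "real ?n + s" 1] \<open>0 < s\<close> \<open>0 \<le> A'\<close> v0 by force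
  define J where "J k x y u u' = weighted_kernel s v w x y *
      ennreal (if dist u x \<le> M * (dist x y / 2 ^ k) \<and> dist u u' \<le> M * (dist x y / 2 ^ k)
        then (dist x y / 2 ^ k) powr (- 2 * real ?n) else 0)" for k :: nat and x y u u'
  let ?c = "K1 * M powr (2 * real ?n + s)"
  have inner: "(\<integral>\<^sup>+y. J k x y u u' \<partial>lborel) \<le>
      ennreal (?c * (2 ^ k) powr - s * w u) *
      ennreal (v x * max (dist x u) (dist u u') powr - (real ?n + (real ?n + s)))"
    if u: "maximal_le A w u" and ne: "u \<noteq> u'" for k x u u'
  proof -
    define m where "m = max (dist x u) (dist u u')"
    \<comment> \<open>The two constraints in \<open>J\<close> together say |x-y| >= \<rho>. Also
      |u-x| <= m <= 2^k m = M \<rho>, as the tail at u requires.\<close>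
    define \<rho> where "\<rho> = 2 ^ k * m / M"
    have m: "0 < m"
      using ne by (auto simp: m_def less_max_iff_disj)
    have \<rho>: "0 < \<rho>"
      using m \<open>0 < M\<close> by (simp add: \<rho>_def)
    have "J k x y u u' \<le> ennreal (v x * (2 ^ k) powr (2 * real ?n)) *
        ennreal (w y * max (dist y x) \<rho> powr - (real ?n + (2 * real ?n + s)))" for y
    proof (cases "dist u x \<le> M * (dist x y / 2 ^ k) \<and> dist u u' \<le> M * (dist x y / 2 ^ k)")
      case True
      then have "\<rho> \<le> dist x y"
        using \<open>0 < M\<close> by (auto simp: \<rho>_def m_def field_simps dist_commute max_def)
      then have r: "max (dist y x) \<rho> = dist x y" "0 < dist x y"
        using \<rho> by (auto simp: dist_commute)
      have "dist x y powr - (real ?n + s) * (dist x y / 2 ^ k) powr (- 2 * real ?n) =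
          (2 ^ k) powr (2 * real ?n) * dist x y powr - (real ?n + (2 * real ?n + s))"
        using r(2) by (simp add: powr_divide powr_minus_divide[of _ "2 * real ?n"] powr_add[symmetric] field_simps)
      then show ?thesis
        using True r v0 w0 by (simp add: J_def weighted_kernel_def mult_ac flip: ennreal_mult)
    qed (auto simp: J_def)
    then have "(\<integral>\<^sup>+y. J k x y u u' \<partial>lborel) \<le> ennreal (v x * (2 ^ k) powr (2 * real ?n)) *
        (\<integral>\<^sup>+y. ennreal (w y * max (dist y x) \<rho> powr - (real ?n + (2 * real ?n + s))) \<partial>lborel)"
      by (subst nn_integral_cmult[symmetric]) (auto intro!: nn_integral_mono)
    also have "\<dots> \<le> ennreal (v x * (2 ^ k) powr (2 * real ?n)) * ennreal (K1 * \<rho> powr - (2 * real ?n + s) * w u)"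
    proof (intro mult_left_mono tail1 u \<rho>)
      have "dist u x \<le> m * 1"
        by (simp add: m_def dist_commute)
      also have "\<dots> \<le> m * 2 ^ k"
        using m by (intro mult_left_mono) auto
      finally show "dist u x \<le> M * \<rho>"
        using \<open>0 < M\<close> by (simp add: \<rho>_def mult.commute)
    qed auto
    also have "\<dots> = ennreal (?c * (2 ^ k) powr - s * w u) * ennreal (v x * m powr - (real ?n + (real ?n + s)))"
    proof -
      have scale: "(z / M) powr - q = z powr - q * M powr q" for z q
        using powr_divide[of z M "- q"] powr_minus[of M q] by (simp only: divide_inverse inverse_inverse_eq)
      have "\<rho> powr - (2 * real ?n + s) =
          (2 ^ k) powr - (2 * real ?n + s) * m powr - (2 * real ?n + s) * M powr (2 * real ?n + s)"
        unfolding \<rho>_def scale by (simp only: powr_mult)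
      then have "(v x * (2 ^ k) powr (2 * real ?n)) * (K1 * \<rho> powr - (2 * real ?n + s) * w u) =
          (?c * ((2 ^ k) powr (2 * real ?n) * (2 ^ k) powr - (2 * real ?n + s)) * w u) *
            (v x * m powr - (2 * real ?n + s))"
        by (simp only: mult_ac)
      also have "(2 ^ k) powr (2 * real ?n) * (2 ^ k :: real) powr - (2 * real ?n + s) = (2 ^ k) powr - s"
        unfolding powr_add[symmetric] by simp
      also have "2 * real ?n + s = real ?n + (real ?n + s)"
        by simp
      finally have "(v x * (2 ^ k) powr (2 * real ?n)) * (K1 * \<rho> powr - (2 * real ?n + s) * w u) =
          (K1 * M powr (2 * real ?n + s) * (2 ^ k) powr - s * w u) *
            (v x * m powr - (real ?n + (real ?n + s)))"
        by simp
      then show ?thesis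
        using \<open>0 \<le> K1\<close> v0 w0 by (simp flip: ennreal_mult)
    qed
    finally show ?thesis
      by (simp add: m_def)
  qed
  have outer: "(\<integral>\<^sup>+x. (\<integral>\<^sup>+y. J k x y u u' \<partial>lborel) \<partial>lborel) \<le>
      ennreal (?c * K2 * (2 ^ k) powr - s) * weighted_kernel s w v u u'"
    if u: "maximal_le A w u" and u': "maximal_le A' v u'" and ne: "u \<noteq> u'" for k u u'
  proof -
    have "(\<integral>\<^sup>+x. (\<integral>\<^sup>+y. J k x y u u' \<partial>lborel) \<partial>lborel) \<le>
        (\<integral>\<^sup>+x. ennreal (?c * (2 ^ k) powr - s * w u) *
          ennreal (v x * max (dist x u) (dist u u') powr - (real ?n + (real ?n + s))) \<partial>lborel)"
      by (intro nn_integral_mono inner u ne)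
    also have "\<dots> = ennreal (?c * (2 ^ k) powr - s * w u) *
        (\<integral>\<^sup>+x. ennreal (v x * max (dist x u) (dist u u') powr - (real ?n + (real ?n + s))) \<partial>lborel)"
      by (intro nn_integral_cmult) measurable
    also have "\<dots> \<le> ennreal (?c * (2 ^ k) powr - s * w u) *
        ennreal (K2 * dist u u' powr - (real ?n + s) * v u')"
      using ne by (intro mult_left_mono tail2 u') (auto simp: dist_commute)
    also have "\<dots> = ennreal (?c * K2 * (2 ^ k) powr - s) * weighted_kernel s w v u u'"
      using \<open>0 \<le> K1\<close> \<open>0 \<le> K2\<close> v0 w0
      by (simp add: weighted_kernel_def mult_ac flip: ennreal_mult)
    finally show ?thesis .
  qed
  have "(\<integral>\<^sup>+x. (\<integral>\<^sup>+y. weighted_kernel s v w x y * local_osc \<Omega> \<theta> f M x (dist x y / 2 ^ k) \<partial>lborel) \<partial>lborel)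
      \<le> ennreal (?c * K2 * (2 ^ k) powr - s) * osc_energy s \<Omega> \<theta> f w v"
    if f[measurable]: "f \<in> borel_measurable borel" for f k
  proof -
    define H where "H = (\<lambda>(x, y, u, u'). osc \<Omega> \<theta> f u u' * J k x y u u')"
    have [measurable]: "H \<in> borel_measurable (borel \<Otimes>\<^sub>M borel \<Otimes>\<^sub>M borel \<Otimes>\<^sub>M borel)"
      unfolding H_def J_def by measurable
    have "(\<integral>\<^sup>+x. (\<integral>\<^sup>+y. weighted_kernel s v w x y * local_osc \<Omega> \<theta> f M x (dist x y / 2 ^ k) \<partial>lborel) \<partial>lborel)
        = (\<integral>\<^sup>+x. (\<integral>\<^sup>+y. (\<integral>\<^sup>+u. (\<integral>\<^sup>+u'. H (x, y, u, u') \<partial>lborel) \<partial>lborel) \<partial>lborel) \<partial>lborel)"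
      unfolding local_osc_def
      by (intro nn_integral_cong, subst nn_integral_cmult[symmetric], measurable, intro nn_integral_cong,
          subst nn_integral_cmult[symmetric], measurable, intro nn_integral_cong)
         (auto simp: H_def J_def mult_ac)
    also have "\<dots> = (\<integral>\<^sup>+u. (\<integral>\<^sup>+u'. (\<integral>\<^sup>+x. (\<integral>\<^sup>+y. H (x, y, u, u') \<partial>lborel) \<partial>lborel) \<partial>lborel) \<partial>lborel)"
      by (rule nn_integral_swap_pairs) measurable
    also have "\<dots> \<le> (\<integral>\<^sup>+u. (\<integral>\<^sup>+u'. ennreal (?c * K2 * (2 ^ k) powr - s) *
        (osc \<Omega> \<theta> f u u' * weighted_kernel s w v u u') \<partial>lborel) \<partial>lborel)"
    proof (rule nn_integral_mono_AE, use max_le(1) in eventually_elim)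
      fix u assume u: "maximal_le A w u"
      show "(\<integral>\<^sup>+u'. (\<integral>\<^sup>+x. (\<integral>\<^sup>+y. H (x, y, u, u') \<partial>lborel) \<partial>lborel) \<partial>lborel) \<le>
        (\<integral>\<^sup>+u'. ennreal (?c * K2 * (2 ^ k) powr - s) *
          (osc \<Omega> \<theta> f u u' * weighted_kernel s w v u u') \<partial>lborel)"
      proof (rule nn_integral_mono_AE, use max_le(2) in eventually_elim)
        fix u' assume u': "maximal_le A' v u'"
        have "(\<integral>\<^sup>+x. (\<integral>\<^sup>+y. H (x, y, u, u') \<partial>lborel) \<partial>lborel) =
            osc \<Omega> \<theta> f u u' * (\<integral>\<^sup>+x. (\<integral>\<^sup>+y. J k x y u u' \<partial>lborel) \<partial>lborel)"
          unfolding H_def J_def prod.case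
          by (subst nn_integral_cmult[symmetric], measurable, intro nn_integral_cong nn_integral_cmult) measurable
        also have "\<dots> \<le> osc \<Omega> \<theta> f u u' * (ennreal (?c * K2 * (2 ^ k) powr - s) * weighted_kernel s w v u u')"
        proof (cases "u = u'")
          case False
          then show ?thesis
            by (intro mult_left_mono outer u u') auto
        qed (simp add: osc_def)
        finally show "(\<integral>\<^sup>+x. (\<integral>\<^sup>+y. H (x, y, u, u') \<partial>lborel) \<partial>lborel) \<le>
            ennreal (?c * K2 * (2 ^ k) powr - s) * (osc \<Omega> \<theta> f u u' * weighted_kernel s w v u u')"
          by (simp add: mult_ac)
      qed
    qed
    also have "\<dots> = ennreal (?c * K2 * (2 ^ k) powr - s) * osc_energy s \<Omega> \<theta> f w v"
      unfolding osc_energy_def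
      by (subst nn_integral_cmult[symmetric], measurable, intro nn_integral_cong nn_integral_cmult) measurable
    finally show ?thesis .
  qed
  moreover have "0 \<le> ?c * K2"
    using \<open>0 \<le> K1\<close> \<open>0 \<le> K2\<close> by simp
  ultimately show ?thesis
    by blast
qed

lemma local_osc_energy_le:
  fixes \<Omega> :: "'a::euclidean_space set"
  assumes w: "borel_A1 A w" and v: "borel_A1 A' v" and \<Omega>: "open \<Omega>" and "0 < s" "0 < M"
  shows "\<exists>K\<ge>0. \<forall>f\<in>borel_measurable borel.
    (\<integral>\<^sup>+x. (\<integral>\<^sup>+y. weighted_kernel s v w x y *
        (\<Sum>k. local_osc \<Omega> \<theta> f M x (dist x y / 2 ^ k)) \<partial>lborel) \<partial>lborel)
      \<le> ennreal K * osc_energy s \<Omega> \<theta> f w v"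
proof -
  have [measurable]: "w \<in> borel_measurable borel" "v \<in> borel_measurable borel" "\<Omega> \<in> sets borel"
    using w v \<Omega> by (auto simp: borel_A1_def)
  obtain K where "0 \<le> K" and K: "\<And>f k. f \<in> borel_measurable borel \<Longrightarrow>
    (\<integral>\<^sup>+x. (\<integral>\<^sup>+y. weighted_kernel s v w x y * local_osc \<Omega> \<theta> f M x (dist x y / 2 ^ k) \<partial>lborel) \<partial>lborel)
      \<le> ennreal (K * (2 ^ k) powr - s) * osc_energy s \<Omega> \<theta> f w v"
    using local_osc_energy_le_dyadic[OF assms] by blast
  have "(\<integral>\<^sup>+x. (\<integral>\<^sup>+y. weighted_kernel s v w x y *
        (\<Sum>k. local_osc \<Omega> \<theta> f M x (dist x y / 2 ^ k)) \<partial>lborel) \<partial>lborel)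
      \<le> ennreal (K / (1 - 2 powr - s)) * osc_energy s \<Omega> \<theta> f w v"
    if f[measurable]: "f \<in> borel_measurable borel" for f
  proof -
    have [measurable]: "(\<lambda>(x, y). local_osc \<Omega> \<theta> f M x (dist x y / 2 ^ k)) \<in>
        borel_measurable (borel \<Otimes>\<^sub>M borel)" for k
      unfolding local_osc_def by measurable
    have "(\<integral>\<^sup>+x. (\<integral>\<^sup>+y. weighted_kernel s v w x y *
        (\<Sum>k. local_osc \<Omega> \<theta> f M x (dist x y / 2 ^ k)) \<partial>lborel) \<partial>lborel) =
      (\<Sum>k. \<integral>\<^sup>+x. (\<integral>\<^sup>+y. weighted_kernel s v w x y *
        local_osc \<Omega> \<theta> f M x (dist x y / 2 ^ k) \<partial>lborel) \<partial>lborel)"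
      unfolding ennreal_suminf_cmult[symmetric]
      by (subst nn_integral_suminf[symmetric], measurable, intro nn_integral_cong nn_integral_suminf) measurable
    also have "\<dots> \<le> (\<Sum>k. ennreal (K * (2 ^ k) powr - s) * osc_energy s \<Omega> \<theta> f w v)"
      by (intro suminf_le summableI K f)
    also have "\<dots> = ennreal (K / (1 - 2 powr - s)) * osc_energy s \<Omega> \<theta> f w v"
      using \<open>0 < s\<close> \<open>0 \<le> K\<close> by (subst ennreal_suminf_multc, subst suminf_ennreal_geometric) auto
    finally show ?thesis .
  qed
  moreover have "0 \<le> K / (1 - 2 powr - s)"
    using \<open>0 \<le> K\<close> \<open>0 < s\<close> powr_less_mono[of "- s" 0 2] by simp
  ultimately show ?thesis
    by blast
qed

section \<open>Comparison of the seminorms for Borel data\<close>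

text \<open>With Borel measurable data on \<^const>\<open>lborel\<close>, Tonelli's theorem applies directly; the iterated
  \<^const>\<open>lebesgue\<close> integrals of the statement need not be jointly measurable.\<close>

definition borel_seminorm ::
  "real \<Rightarrow> 'a::euclidean_space set \<Rightarrow> ('a \<Rightarrow> real) \<Rightarrow> ('a \<Rightarrow> real) \<Rightarrow> ('a \<Rightarrow> real) \<Rightarrow> ennreal" where
  "borel_seminorm s \<Omega> f w v = (\<integral>\<^sup>+x. (\<integral>\<^sup>+y.
     (if x \<in> \<Omega> \<and> y \<in> \<Omega> then ennreal \<bar>f x - f y\<bar> * weighted_kernel s v w x y else 0) \<partial>lborel) \<partial>lborel)"

text \<open>As \<theta> <= 1, the visible balls stay inside the domain, so each order of the weights
  is bounded by a full seminorm. The two full seminorms agree, since exchanging x and y exchanges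
  the weights.\<close>

lemma osc_energy_le_borel_seminorm:
  assumes [measurable]: "w \<in> borel_measurable borel" "v \<in> borel_measurable borel" "f \<in> borel_measurable borel"
    and "open \<Omega>" and "\<theta> \<le> 1"
  shows "osc_energy s \<Omega> \<theta> f w v + osc_energy s \<Omega> \<theta> f v w \<le> 2 * borel_seminorm s \<Omega> f w v"
proof -
  have [measurable]: "\<Omega> \<in> sets borel"
    using assms by auto
  have le: "osc \<Omega> \<theta> f x y * weighted_kernel s w v x y \<le>
      (if x \<in> \<Omega> \<and> y \<in> \<Omega> then ennreal \<bar>f x - f y\<bar> * weighted_kernel s w v x y else 0)" for x y w v
  proof (cases "x \<in> \<Omega> \<and> dist x y < \<theta> * bdist \<Omega> x")
    case True
    have "\<theta> * bdist \<Omega> x \<le> 1 * bdist \<Omega> x"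
      using assms by (intro mult_right_mono) (auto simp: bdist_def infdist_nonneg)
    then have "y \<in> \<Omega>"
      using True ball_bdist_subset[of x \<Omega>] by auto
    then show ?thesis
      using True by (simp add: osc_def)
  qed (auto simp: osc_def)
  have "osc_energy s \<Omega> \<theta> f v w \<le> borel_seminorm s \<Omega> f w v"
    unfolding osc_energy_def borel_seminorm_def by (intro nn_integral_mono le)
  moreover have "osc_energy s \<Omega> \<theta> f w v \<le> borel_seminorm s \<Omega> f v w"
    unfolding osc_energy_def borel_seminorm_def by (intro nn_integral_mono le)
  moreover have "borel_seminorm s \<Omega> f v w = borel_seminorm s \<Omega> f w v"
    unfolding borel_seminorm_def
    by (subst lborel_pair.Fubini', measurable, intro nn_integral_cong)
       (auto simp: weighted_kernel_commute[of s w v] abs_minus_commute)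
  ultimately show ?thesis
    unfolding mult_2 by (simp add: add_mono)
qed

text \<open>Each pair is visible from x, visible from y, or far enough from the boundary scale for
  \<open>pointwise_estimate\<close>. The contributions of y are those of x with points and weights
  exchanged, so one bound, used in both orders, covers everything.\<close>

lemma (in uniform_curves) borel_seminorm_le_osc_energy:
  assumes w: "borel_A1 A w" and v: "borel_A1 A' v" and "0 < s" "0 < \<theta>" "\<theta> \<le> 1"
  shows "\<exists>K\<ge>0. \<forall>f\<in>borel_measurable borel.
    borel_seminorm s \<Omega> f w v \<le> ennreal K * (osc_energy s \<Omega> \<theta> f w v + osc_energy s \<Omega> \<theta> f v w)"
proof -
  have [measurable]: "w \<in> borel_measurable borel" "v \<in> borel_measurable borel" "\<Omega> \<in> sets borel"
    using w v open_domain by (auto simp: borel_A1_def)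
  obtain K0 M where "0 < K0" "0 < M" and pointwise: "\<And>f x y. f \<in> borel_measurable borel \<Longrightarrow> x \<in> \<Omega> \<Longrightarrow> y \<in> \<Omega> \<Longrightarrow>
    x \<noteq> y \<Longrightarrow> \<theta> * bdist \<Omega> x \<le> dist x y \<Longrightarrow> \<theta> * bdist \<Omega> y \<le> dist x y \<Longrightarrow>
    ennreal \<bar>f x - f y\<bar> \<le> ennreal K0 *
      ((end_osc \<Omega> \<theta> f x + (\<Sum>k. local_osc \<Omega> \<theta> f M x (dist x y / 2 ^ k))) +
       (end_osc \<Omega> \<theta> f y + (\<Sum>k. local_osc \<Omega> \<theta> f M y (dist x y / 2 ^ k))))"
    using pointwise_estimate[OF assms(4,5)] by blast
  define E where "E f w v x y = (if x \<in> \<Omega> \<and> \<theta> * bdist \<Omega> x \<le> dist x y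
        then end_osc \<Omega> \<theta> f x * weighted_kernel s v w x y else 0)" for f w v x y
  define L where "L f w v x y = weighted_kernel s v w x y *
        (\<Sum>k. local_osc \<Omega> \<theta> f M x (dist x y / 2 ^ k))" for f w v x y
  \<comment> \<open>All contributions charged to the first point: the pair if visible from it, the
    end term and the chain terms.\<close>
  define F where "F f w v x y = osc \<Omega> \<theta> f x y * weighted_kernel s v w x y +
      ennreal K0 * (E f w v x y + L f w v x y)" for f w v x y
  have F_measurable [measurable]: "(\<lambda>(x, y). F f w v x y) \<in> borel_measurable (borel \<Otimes>\<^sub>M borel)"
    if [measurable]: "f \<in> borel_measurable borel" "w \<in> borel_measurable borel" "v \<in> borel_measurable borel"
    for f w v
    unfolding F_def E_def L_def end_osc_def local_osc_def by measurable
  have F_le: "\<exists>K\<ge>0. \<forall>f\<in>borel_measurable borel. (\<integral>\<^sup>+x. (\<integral>\<^sup>+y. F f w v x y \<partial>lborel) \<partial>lborel) \<le>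
      ennreal K * (osc_energy s \<Omega> \<theta> f w v + osc_energy s \<Omega> \<theta> f v w)"
    if w: "borel_A1 A w" and v: "borel_A1 A' v" for A A' w v
  proof -
    have [measurable]: "w \<in> borel_measurable borel" "v \<in> borel_measurable borel" and v0: "\<And>x. 0 \<le> v x"
      using w v by (auto simp: borel_A1_def)
    obtain K1 where "0 \<le> K1" and K1: "\<And>f. f \<in> borel_measurable borel \<Longrightarrow>
        (\<integral>\<^sup>+x. (\<integral>\<^sup>+y. E f w v x y \<partial>lborel) \<partial>lborel) \<le> ennreal K1 * osc_energy s \<Omega> \<theta> f v w"
      using end_osc_energy_le[OF w \<open>v \<in> borel_measurable borel\<close> v0 open_domain frontier assms(3-5)]
      unfolding E_def by auto
    obtain K2 where "0 \<le> K2" and K2: "\<And>f. f \<in> borel_measurable borel \<Longrightarrow>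
        (\<integral>\<^sup>+x. (\<integral>\<^sup>+y. L f w v x y \<partial>lborel) \<partial>lborel) \<le> ennreal K2 * osc_energy s \<Omega> \<theta> f w v"
      using local_osc_energy_le[OF w v open_domain \<open>0 < s\<close> \<open>0 < M\<close>, of \<theta>] unfolding L_def by auto
    have "(\<integral>\<^sup>+x. (\<integral>\<^sup>+y. F f w v x y \<partial>lborel) \<partial>lborel) \<le>
        ennreal (1 + K0 * (K1 + K2)) * (osc_energy s \<Omega> \<theta> f w v + osc_energy s \<Omega> \<theta> f v w)"
      if f[measurable]: "f \<in> borel_measurable borel" for f
    proof -
      let ?P = "osc_energy s \<Omega> \<theta> f w v + osc_energy s \<Omega> \<theta> f v w"
      have [measurable]: "(\<lambda>(x, y). E f w v x y) \<in> borel_measurable (borel \<Otimes>\<^sub>M borel)"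
        "(\<lambda>(x, y). L f w v x y) \<in> borel_measurable (borel \<Otimes>\<^sub>M borel)"
        unfolding E_def L_def end_osc_def local_osc_def by measurable
      have "(\<integral>\<^sup>+x. (\<integral>\<^sup>+y. F f w v x y \<partial>lborel) \<partial>lborel) = osc_energy s \<Omega> \<theta> f v w + ennreal K0 *
          ((\<integral>\<^sup>+x. (\<integral>\<^sup>+y. E f w v x y \<partial>lborel) \<partial>lborel) + (\<integral>\<^sup>+x. (\<integral>\<^sup>+y. L f w v x y \<partial>lborel) \<partial>lborel))"
        unfolding F_def osc_energy_def by (simp add: nn_integral_add nn_integral_cmult)
      also have "\<dots> \<le> ?P + ennreal K0 * (ennreal K1 * ?P + ennreal K2 * ?P)"
        by (intro add_mono mult_left_mono order_trans[OF K1[OF f]] order_trans[OF K2[OF f]]) auto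
      also have "\<dots> = ennreal (1 + K0 * (K1 + K2)) * ?P"
        using \<open>0 < K0\<close> \<open>0 \<le> K1\<close> \<open>0 \<le> K2\<close> by (simp add: distrib_right distrib_left ennreal_mult mult.assoc)
      finally show ?thesis .
    qed
    moreover have "0 \<le> 1 + K0 * (K1 + K2)"
      using \<open>0 < K0\<close> \<open>0 \<le> K1\<close> \<open>0 \<le> K2\<close> by simp
    ultimately show ?thesis
      by blast
  qed
  obtain K1 where "0 \<le> K1" and K1: "\<And>f. f \<in> borel_measurable borel \<Longrightarrow>
      (\<integral>\<^sup>+x. (\<integral>\<^sup>+y. F f w v x y \<partial>lborel) \<partial>lborel) \<le>
      ennreal K1 * (osc_energy s \<Omega> \<theta> f w v + osc_energy s \<Omega> \<theta> f v w)"
    using F_le[OF w v] by blast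
  obtain K2 where "0 \<le> K2" and K2: "\<And>f. f \<in> borel_measurable borel \<Longrightarrow>
      (\<integral>\<^sup>+x. (\<integral>\<^sup>+y. F f v w x y \<partial>lborel) \<partial>lborel) \<le>
      ennreal K2 * (osc_energy s \<Omega> \<theta> f v w + osc_energy s \<Omega> \<theta> f w v)"
    using F_le[OF v w] by blast
  have "borel_seminorm s \<Omega> f w v \<le> ennreal (K1 + K2) * (osc_energy s \<Omega> \<theta> f w v + osc_energy s \<Omega> \<theta> f v w)"
    if f[measurable]: "f \<in> borel_measurable borel" for f
  proof -
    have split: "(if x \<in> \<Omega> \<and> y \<in> \<Omega> then ennreal \<bar>f x - f y\<bar> * weighted_kernel s v w x y else 0) \<le>
        F f w v x y + F f v w y x" for x y
    proof (cases "x \<in> \<Omega> \<and> y \<in> \<Omega> \<and> x \<noteq> y")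
      case True
      consider "dist x y < \<theta> * bdist \<Omega> x" | "dist x y < \<theta> * bdist \<Omega> y"
        | "\<theta> * bdist \<Omega> x \<le> dist x y" "\<theta> * bdist \<Omega> y \<le> dist x y"
        by linarith
      then show ?thesis
      proof cases
        case 1
        then show ?thesis
          using True by (auto simp: F_def osc_def add.assoc)
      next
        case 2
        then have "ennreal \<bar>f x - f y\<bar> * weighted_kernel s v w x y = osc \<Omega> \<theta> f y x * weighted_kernel s w v y x"
          using True by (simp add: osc_def dist_commute abs_minus_commute weighted_kernel_commute[of s w v])
        also have "\<dots> \<le> F f v w y x"
          by (simp add: F_def)
        also have "\<dots> \<le> F f w v x y + F f v w y x"
          by simp
        finally show ?thesis
          using True by simp
      next
        case 3
        have "ennreal \<bar>f x - f y\<bar> * weighted_kernel s v w x y \<le> ennreal K0 *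
          ((end_osc \<Omega> \<theta> f x + (\<Sum>k. local_osc \<Omega> \<theta> f M x (dist x y / 2 ^ k))) +
           (end_osc \<Omega> \<theta> f y + (\<Sum>k. local_osc \<Omega> \<theta> f M y (dist x y / 2 ^ k)))) * weighted_kernel s v w x y"
          using True 3 by (intro mult_right_mono pointwise f) auto
        also have "\<dots> = ennreal K0 * (E f w v x y + L f w v x y) + ennreal K0 * (E f v w y x + L f v w y x)"
          using True 3
          by (simp add: E_def L_def dist_commute[of y x] weighted_kernel_commute[of s w v y x] distrib_left distrib_right mult_ac)
        also have "\<dots> \<le> F f w v x y + F f v w y x"
          unfolding F_def by (intro add_mono) auto
        finally show ?thesis
          using True by simp
      qed
    qed auto
    have "borel_seminorm s \<Omega> f w v \<le> (\<integral>\<^sup>+x. (\<integral>\<^sup>+y. F f w v x y + F f v w y x \<partial>lborel) \<partial>lborel)"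
      unfolding borel_seminorm_def by (intro nn_integral_mono split)
    also have "\<dots> = (\<integral>\<^sup>+x. (\<integral>\<^sup>+y. F f w v x y \<partial>lborel) \<partial>lborel) + (\<integral>\<^sup>+x. (\<integral>\<^sup>+y. F f v w y x \<partial>lborel) \<partial>lborel)"
      by (simp add: nn_integral_add)
    also have "(\<integral>\<^sup>+x. (\<integral>\<^sup>+y. F f v w y x \<partial>lborel) \<partial>lborel) = (\<integral>\<^sup>+y. (\<integral>\<^sup>+x. F f v w y x \<partial>lborel) \<partial>lborel)"
      by (intro lborel_pair.Fubini') measurable
    also have "(\<integral>\<^sup>+x. (\<integral>\<^sup>+y. F f w v x y \<partial>lborel) \<partial>lborel) + \<dots> \<le>
        ennreal K1 * (osc_energy s \<Omega> \<theta> f w v + osc_energy s \<Omega> \<theta> f v w) +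
        ennreal K2 * (osc_energy s \<Omega> \<theta> f v w + osc_energy s \<Omega> \<theta> f w v)"
      by (intro add_mono K1 K2 f)
    also have "\<dots> = ennreal (K1 + K2) * (osc_energy s \<Omega> \<theta> f w v + osc_energy s \<Omega> \<theta> f v w)"
      using \<open>0 \<le> K1\<close> \<open>0 \<le> K2\<close> by (simp add: distrib_right add.commute)
    finally show ?thesis .
  qed
  moreover have "0 \<le> K1 + K2"
    using \<open>0 \<le> K1\<close> \<open>0 \<le> K2\<close> by simp
  ultimately show ?thesis
    by blast
qed

section \<open>Borel representatives\<close>

text \<open>Integrability is given on compact subsets; measurability on the whole domain follows as
  a pointwise limit along a compact exhaustion.\<close>

lemma L1_loc_measurable:
  fixes \<Omega> :: "'a::euclidean_space set"
  assumes "open \<Omega>" "f \<in> L1_loc \<Omega>"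
  shows "(\<lambda>x. indicator \<Omega> x * f x) \<in> borel_measurable lebesgue"
proof -
  obtain C :: "nat \<Rightarrow> 'a set" where C: "\<And>n. compact (C n)" "\<And>n. C n \<subseteq> \<Omega>"
    "\<And>n. C n \<subseteq> interior (C (Suc n))" "\<Union>(range C) = \<Omega>"
    using open_Union_compact_subsets[OF assms(1)] by metis
  have "incseq C"
    using C(3) interior_subset by (intro incseq_SucI) blast
  have "(\<lambda>n. indicat_real (C n) x) \<longlonglongrightarrow> indicat_real \<Omega> x" for x
    using LIMSEQ_indicator_incseq[OF \<open>incseq C\<close>, of x] C(4) by simp
  then have "(\<lambda>n. indicat_real (C n) x * f x) \<longlonglongrightarrow> indicat_real \<Omega> x * f x" for x
    by (intro tendsto_mult_right)
  moreover have "(\<lambda>x. indicat_real (C n) x * f x) \<in> borel_measurable lebesgue" for n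
  proof -
    have "f absolutely_integrable_on C n"
      using assms(2) C by (auto simp: L1_loc_def)
    then show ?thesis
      using borel_measurable_integrable by (auto simp: set_integrable_def)
  qed
  ultimately show ?thesis
    by (rule borel_measurable_LIMSEQ_real)
qed

lemma L1_loc_borel_representative:
  fixes \<Omega> :: "'a::euclidean_space set"
  assumes "open \<Omega>" "f \<in> L1_loc \<Omega>"
  shows "\<exists>g\<in>borel_measurable borel. AE x in lborel. x \<in> \<Omega> \<longrightarrow> f x = g x"
proof -
  obtain g where "g \<in> borel_measurable lborel" "AE x in lborel. indicator \<Omega> x * f x = g x"
    using completion_ex_borel_measurable_real[OF L1_loc_measurable[OF assms]] by blast
  then show ?thesis
    by (intro bexI[of _ g]) (auto elim: eventually_mono simp: indicator_def)
qed

text \<open>The tail estimates need centred balls. A ball lies in a cube of comparable volume that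
  also contains the centre, so averages over cubes control it.\<close>

lemma muckenhoupt_A1_borel_representative:
  fixes w :: "'a::euclidean_space \<Rightarrow> real"
  assumes "w \<in> muckenhoupt_A1"
  shows "\<exists>A g. borel_A1 A g \<and> (AE x in lborel. w x = g x)"
proof -
  let ?n = "DIM('a)"
  obtain A where "0 < A" and A: "\<And>Q. Q \<in> cubes \<Longrightarrow> AE y in lebesgue. y \<in> Q \<longrightarrow>
      (LINT x:Q|lebesgue. w x) / measure lebesgue Q \<le> A * w y"
    and int: "\<And>K. compact K \<Longrightarrow> w absolutely_integrable_on K" and pos: "AE x in lborel. 0 < w x"
    using assms by (auto simp: muckenhoupt_A1_def weight_def AE_completion_iff)
  obtain g0 where g0: "g0 \<in> borel_measurable borel" "AE x in lborel. w x = g0 x"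
    using L1_loc_borel_representative[of UNIV w] int by (auto simp: L1_loc_def)
  define g where "g x = max 0 (g0 x)" for x
  have [measurable]: "g \<in> borel_measurable borel"
    using g0(1) unfolding g_def by measurable
  have w_g: "AE x in lborel. w x = g x"
    using g0(2) pos by eventually_elim (simp add: g_def)
  \<comment> \<open>The null set in the $A_1$ condition depends on the cube; countably many cubes suffice to
    catch every ball up to a factor in volume.\<close>
  obtain D :: "'a set" where D: "countable D" "\<And>X. open X \<Longrightarrow> X \<noteq> {} \<Longrightarrow> \<exists>d\<in>D. d \<in> X"
    using countable_dense_setE by blast
  define Q where "Q a l = cbox a (a + l *\<^sub>R One)" for a :: 'a and l :: real
  have vol: "measure lebesgue (Q a l) = l ^ ?n" if "0 < l" for a l
    using that by (simp add: Q_def content_cbox algebra_simps)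
  have avg: "AE y in lborel. y \<in> Q a l \<longrightarrow> (\<integral>\<^sup>+z\<in>Q a l. ennreal (g z) \<partial>lborel) \<le> ennreal (A * l ^ ?n * g y)"
    if "0 < l" for a l
  proof -
    have "Q a l \<in> cubes"
      using that by (auto simp: Q_def cubes_def)
    then have "AE y in lborel. y \<in> Q a l \<longrightarrow>
        (LINT x:Q a l|lebesgue. w x) / measure lebesgue (Q a l) \<le> A * w y"
      using A by (simp add: AE_completion_iff)
    moreover have eq: "(\<integral>\<^sup>+z\<in>Q a l. ennreal (g z) \<partial>lborel) = ennreal (LINT x:Q a l|lebesgue. w x)"
    proof -
      have "(\<integral>\<^sup>+z\<in>Q a l. ennreal (g z) \<partial>lborel) = (\<integral>\<^sup>+z. ennreal (indicator (Q a l) z *\<^sub>R w z) \<partial>lebesgue)"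
        unfolding nn_integral_completion using w_g
        by (intro nn_integral_cong_AE) (auto elim!: eventually_mono simp: indicator_def)
      also have "\<dots> = ennreal (LINT x:Q a l|lebesgue. w x)"
        unfolding set_lebesgue_integral_def
      proof (rule nn_integral_eq_integral)
        show "integrable lebesgue (\<lambda>x. indicat_real (Q a l) x *\<^sub>R w x)"
          using int[of "Q a l"] by (simp add: Q_def set_integrable_def)
        show "AE x in lebesgue. 0 \<le> indicat_real (Q a l) x *\<^sub>R w x"
          unfolding AE_completion_iff using pos by eventually_elim (simp add: indicator_def)
      qed
      finally show ?thesis .
    qed
    ultimately show ?thesis
      using w_g
    proof eventually_elim
      case (elim y)
      then show ?case
        using that unfolding eq by (auto simp: vol field_simps intro!: ennreal_leI)
    qed
  qed
  have "AE y in lborel. \<forall>(a, l)\<in>D \<times> (\<rat> \<inter> {0<..}). y \<in> Q a l \<longrightarrow>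
      (\<integral>\<^sup>+z\<in>Q a l. ennreal (g z) \<partial>lborel) \<le> ennreal (A * l ^ ?n * g y)"
    using avg D(1) countable_rat by (intro AE_ball_countable') auto
  then have "AE y in lborel. maximal_le (A * 5 ^ ?n) g y"
  proof eventually_elim
    fix y assume y: "\<forall>(a, l)\<in>D \<times> (\<rat> \<inter> {0<..}). y \<in> Q a l \<longrightarrow>
      (\<integral>\<^sup>+z\<in>Q a l. ennreal (g z) \<partial>lborel) \<le> ennreal (A * l ^ ?n * g y)"
    show "maximal_le (A * 5 ^ ?n) g y"
      unfolding maximal_le_def
    proof (intro allI impI)
      fix R :: real assume R: "0 < R"
      \<comment> \<open>Coordinatewise a lies between y - 3R and y - R, so with 4R < l the cube
        reaches from below y - R to above y + R. The bound l < 5R accounts for the factor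
        5^d.\<close>
      obtain a where a: "a \<in> D" "dist (y - (2 * R) *\<^sub>R One) a < R"
        using D(2)[of "ball (y - (2 * R) *\<^sub>R One) R"] R by auto
      obtain l where l: "l \<in> \<rat>" "4 * R < l" "l < 5 * R"
        using Rats_dense_in_real[of "4 * R" "5 * R"] R by auto
      have sub: "ball y R \<subseteq> Q a l"
      proof
        fix z assume z: "z \<in> ball y R"
        have "a \<bullet> i \<le> z \<bullet> i \<and> z \<bullet> i \<le> a \<bullet> i + l" if i: "i \<in> Basis" for i
        proof -
          have "\<bar>(y - z) \<bullet> i\<bar> < R"
            using Basis_le_norm[OF i, of "y - z"] z by (simp add: dist_norm)
          moreover have "\<bar>(y - (2 * R) *\<^sub>R One - a) \<bullet> i\<bar> < R"
            using Basis_le_norm[OF i, of "y - (2 * R) *\<^sub>R One - a"] a by (simp add: dist_norm)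
          ultimately show ?thesis
            using l i by (auto simp: inner_diff_left abs_less_iff)
        qed
        then show "z \<in> Q a l"
          by (simp add: Q_def mem_box inner_add_left)
      qed
      have "(\<integral>\<^sup>+z\<in>ball y R. ennreal (g z) \<partial>lborel) \<le> (\<integral>\<^sup>+z\<in>Q a l. ennreal (g z) \<partial>lborel)"
        using sub by (intro nn_integral_mono) (auto simp: indicator_def)
      also have "\<dots> \<le> ennreal (A * l ^ ?n * g y)"
      proof -
        have "0 < l" "y \<in> Q a l"
          using l R sub by auto
        then show ?thesis
          using y a(1) l(1) by auto
      qed
      also have "\<dots> \<le> ennreal (A * (5 * R) ^ ?n * g y)"
        using l R \<open>0 < A\<close> by (intro ennreal_leI mult_right_mono mult_left_mono power_mono) (auto simp: g_def)
      finally show "(\<integral>\<^sup>+z\<in>ball y R. ennreal (g z) \<partial>lborel) \<le> ennreal (A * 5 ^ ?n * R ^ ?n * g y)"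
        by (simp add: power_mult_distrib mult.assoc)
    qed
  qed
  then have "borel_A1 (A * 5 ^ ?n) g"
    using \<open>0 < A\<close> by (auto simp: borel_A1_def g_def)
  then show ?thesis
    using w_g by blast
qed

text \<open>\<open>nn_integral_completion\<close> passes from \<open>lebesgue\<close> to
  \<open>lborel\<close> for arbitrary integrands. The data are then replaced for almost every x and,
  with x fixed, for almost every y, so joint measurability does not enter.\<close>

lemma full_seminorm_eq_borel:
  fixes \<Omega> :: "'a::euclidean_space set"
  assumes w: "AE x in lborel. w x = w' x" and v: "AE x in lborel. v x = v' x"
    and f: "AE x in lborel. x \<in> \<Omega> \<longrightarrow> f x = f' x"
  shows "full_seminorm s w v \<Omega> f = borel_seminorm s \<Omega> f' w' v'"
  unfolding full_seminorm_def borel_seminorm_def nn_integral_completion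
proof (rule nn_integral_cong_AE, use v f in eventually_elim)
  fix x assume x: "v x = v' x" "x \<in> \<Omega> \<longrightarrow> f x = f' x"
  have "(\<integral>\<^sup>+y\<in>\<Omega>. ennreal (\<bar>f x - f y\<bar> / norm (x - y) powr (real DIM('a) + s) * (w y * v x)) \<partial>lborel) =
      (\<integral>\<^sup>+y. (if x \<in> \<Omega> \<and> y \<in> \<Omega> then ennreal \<bar>f' x - f' y\<bar> * weighted_kernel s v' w' x y else 0) \<partial>lborel)"
    if "x \<in> \<Omega>"
  proof (rule nn_integral_cong_AE, use w f in eventually_elim)
    case (elim y)
    have "weighted_kernel s v' w' x y = ennreal (1 / norm (x - y) powr (real DIM('a) + s) * (v' x * w' y))"
      unfolding weighted_kernel_def dist_norm powr_minus_divide ..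
    then show ?case
      using elim x that by (auto simp: indicator_def mult_ac simp flip: ennreal_mult')
  qed
  then show "(\<integral>\<^sup>+y\<in>\<Omega>. ennreal (\<bar>f x - f y\<bar> / norm (x - y) powr (real DIM('a) + s) * (w y * v x)) \<partial>lborel) *
      indicator \<Omega> x =
      (\<integral>\<^sup>+y. (if x \<in> \<Omega> \<and> y \<in> \<Omega> then ennreal \<bar>f' x - f' y\<bar> * weighted_kernel s v' w' x y else 0) \<partial>lborel)"
    by (cases "x \<in> \<Omega>") auto
qed

text \<open>The inner integral does not mention the domain; \<theta> <= 1 keeps its ball inside,
  where f agrees with its representative almost everywhere.\<close>

lemma truncated_seminorm_eq_osc_energy:
  fixes \<Omega> :: "'a::euclidean_space set"
  assumes w: "AE x in lborel. w x = w' x" and v: "AE x in lborel. v x = v' x"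
    and f: "AE x in lborel. x \<in> \<Omega> \<longrightarrow> f x = f' x"
    and [measurable]: "w' \<in> borel_measurable borel" "v' \<in> borel_measurable borel" "f' \<in> borel_measurable borel"
    and pos: "\<And>x. 0 \<le> w' x" "\<And>x. 0 \<le> v' x" and "open \<Omega>" "\<theta> \<le> 1"
  shows "truncated_seminorm s \<theta> w v \<Omega> f = osc_energy s \<Omega> \<theta> f' w' v' + osc_energy s \<Omega> \<theta> f' v' w'"
proof -
  have [measurable]: "\<Omega> \<in> sets borel"
    using assms by auto
  have "truncated_seminorm s \<theta> w v \<Omega> f = (\<integral>\<^sup>+x. (\<integral>\<^sup>+y. osc \<Omega> \<theta> f' x y *
      (weighted_kernel s w' v' x y + weighted_kernel s v' w' x y) \<partial>lborel) \<partial>lborel)"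
    unfolding truncated_seminorm_def nn_integral_completion
  proof (rule nn_integral_cong_AE, use v w f in eventually_elim)
    fix x assume x: "v x = v' x" "w x = w' x" "x \<in> \<Omega> \<longrightarrow> f x = f' x"
    let ?B = "ball x (\<theta> * bdist \<Omega> x)"
    have "(\<integral>\<^sup>+y\<in>?B. ennreal (\<bar>f x - f y\<bar> / norm (x - y) powr (real DIM('a) + s) * (w x * v y + w y * v x)) \<partial>lborel) =
      (\<integral>\<^sup>+y. osc \<Omega> \<theta> f' x y * (weighted_kernel s w' v' x y + weighted_kernel s v' w' x y) \<partial>lborel)"
      if "x \<in> \<Omega>"
    proof (rule nn_integral_cong_AE, use w v f in eventually_elim)
      case (elim y)
      show ?case
      proof (cases "y \<in> ?B")
        case True
        have "\<theta> * bdist \<Omega> x \<le> 1 * bdist \<Omega> x"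
          using \<open>\<theta> \<le> 1\<close> by (intro mult_right_mono) (auto simp: bdist_def infdist_nonneg)
        then have "y \<in> \<Omega>"
          using True ball_bdist_subset[OF \<open>x \<in> \<Omega>\<close>] by auto
        have "weighted_kernel s w' v' x y + weighted_kernel s v' w' x y =
            ennreal (norm (x - y) powr - (real DIM('a) + s) * (w' x * v' y + w' y * v' x))"
          using pos by (simp add: weighted_kernel_def dist_norm algebra_simps flip: ennreal_plus)
        moreover have "norm (x - y) powr - (real DIM('a) + s) = 1 / norm (x - y) powr (real DIM('a) + s)"
          by (rule powr_minus_divide)
        ultimately show ?thesis
          using True \<open>y \<in> \<Omega>\<close> x elim \<open>x \<in> \<Omega>\<close>
          by (simp add: osc_def flip: ennreal_mult')
      qed (simp add: osc_def)
    qed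
    then show "(\<integral>\<^sup>+y\<in>?B. ennreal (\<bar>f x - f y\<bar> / norm (x - y) powr (real DIM('a) + s) * (w x * v y + w y * v x)) \<partial>lborel) *
      indicator \<Omega> x =
      (\<integral>\<^sup>+y. osc \<Omega> \<theta> f' x y * (weighted_kernel s w' v' x y + weighted_kernel s v' w' x y) \<partial>lborel)"
      by (cases "x \<in> \<Omega>") (auto simp: osc_def)
  qed
  also have "\<dots> = osc_energy s \<Omega> \<theta> f' w' v' + osc_energy s \<Omega> \<theta> f' v' w'"
    unfolding osc_energy_def by (simp add: distrib_left nn_integral_add)
  finally show ?thesis .
qed

theorem theorem23:
  fixes \<Omega> :: "'a::euclidean_space set" and s \<theta> :: real and w v :: "'a \<Rightarrow> real"
  assumes "\<Omega> \<noteq> {}" and "bounded \<Omega>" and "uniform_domain \<Omega>"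
    and "0 < s" and "s < 1" and "0 < \<theta>" and "\<theta> \<le> 1"
    and "w \<in> muckenhoupt_A1" and "v \<in> muckenhoupt_A1"
  shows "\<exists>C::real. 0 < C \<and> (\<forall>f \<in> L1_loc \<Omega>.
           full_seminorm s w v \<Omega> f \<le> ennreal C * truncated_seminorm s \<theta> w v \<Omega> f \<and>
           truncated_seminorm s \<theta> w v \<Omega> f \<le> ennreal C * full_seminorm s w v \<Omega> f)"
proof -
  have "frontier \<Omega> \<noteq> {}"
    using assms(1,2) frontier_eq_empty not_bounded_UNIV by blast
  then obtain C where "uniform_curves \<Omega> C"
    using uniform_domain_curves[OF assms(3)] by blast
  then interpret uniform_curves \<Omega> C .
  obtain A w' where w': "borel_A1 A w'" "AE x in lborel. w x = w' x"
    using muckenhoupt_A1_borel_representative[OF assms(8)] by blast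
  obtain A' v' where v': "borel_A1 A' v'" "AE x in lborel. v x = v' x"
    using muckenhoupt_A1_borel_representative[OF assms(9)] by blast
  obtain K where "0 \<le> K" and K: "\<And>f. f \<in> borel_measurable borel \<Longrightarrow>
      borel_seminorm s \<Omega> f w' v' \<le> ennreal K * (osc_energy s \<Omega> \<theta> f w' v' + osc_energy s \<Omega> \<theta> f v' w')"
    using borel_seminorm_le_osc_energy[OF w'(1) v'(1) assms(4,6,7)] by blast
  \<comment> \<open>K serves the first inequality; 2 serves the second, once for each order of the
    weights.\<close>
  have "full_seminorm s w v \<Omega> f \<le> ennreal (K + 2) * truncated_seminorm s \<theta> w v \<Omega> f \<and>
      truncated_seminorm s \<theta> w v \<Omega> f \<le> ennreal (K + 2) * full_seminorm s w v \<Omega> f"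
    if f: "f \<in> L1_loc \<Omega>" for f
  proof -
    obtain g where g: "g \<in> borel_measurable borel" "AE x in lborel. x \<in> \<Omega> \<longrightarrow> f x = g x"
      using L1_loc_borel_representative[OF open_domain f] by blast
    have full: "full_seminorm s w v \<Omega> f = borel_seminorm s \<Omega> g w' v'"
      using w' v' g by (intro full_seminorm_eq_borel)
    have trunc: "truncated_seminorm s \<theta> w v \<Omega> f = osc_energy s \<Omega> \<theta> g w' v' + osc_energy s \<Omega> \<theta> g v' w'"
      using w' v' g open_domain assms(7)
      by (intro truncated_seminorm_eq_osc_energy) (auto simp: borel_A1_def)
    have "ennreal K \<le> ennreal (K + 2)" "(2::ennreal) \<le> ennreal (K + 2)"
      using \<open>0 \<le> K\<close> ennreal_leI[of 2 "K + 2"] by (auto intro: ennreal_leI)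
    moreover have "truncated_seminorm s \<theta> w v \<Omega> f \<le> 2 * full_seminorm s w v \<Omega> f"
      unfolding full trunc using w' v' g open_domain assms(7)
      by (intro osc_energy_le_borel_seminorm) (auto simp: borel_A1_def)
    ultimately show ?thesis
      using K[OF g(1)] unfolding full[symmetric] trunc[symmetric]
      by (meson mult_right_mono order_trans zero_le)
  qed
  then show ?thesis
    using \<open>0 \<le> K\<close> by (intro exI[of _ "K + 2"]) auto
qed

end
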